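(* For every $n\ge2$, $Fl_n^{\ge 0}=\{F\in Fl_n:\ P_I(F)\ge 0 \text{ for all } I\subset[n]\}$; that is, a complete flag lies in Lusztig's totally non-negative complete flag variety if and only if it has non-negative Plücker coordinates.
   Context: A complete flag in $\mathbb R^n$ is a chain $\{0\}=V_0\subsetneq V_1\subsetneq\cdots\subsetneq V_n=\mathbb R^n$ of linear subspaces; $Fl_n$ is the set of complete flags. A flag is represented by an invertible real $n\times n$ matrix $M$ whose first $i$ rows span $V_i$ for each $i$; two matrices represent the same flag iff they differ by left multiplication by an invertible lower triangular matrix. For $I\subset[n]$, the Plücker coordinate $P_I(M)$ is the determinant of the submatrix of $M$ in rows $\{1,\dots,|I|\}$ and columns $I$. We say $P_I(F)\ge0$ for all $I$ if some matrix representative $M$ of $F$ satisfies $P_I(M)\ge 0$ for all $I\subset[n]$. Lusztig's TNN flag variety: for $1\le k<n$ and $a\in\mathbb R$, $x_k(a)$ is the $n\times n$ identity matrix with an extra entry $a$ in row $k$, column $k+1$. Let $s_i=(i,i+1)\in S_n$, $N=\binom n2$, and choose $(i_1,\dots,i_N)$ with $s_{i_1}\cdots s_{i_N}=w_0$, the longest permutation of $S_n$. Let $U^+_{>0}=\{x_{i_1}(a_1)\cdots x_{i_N}(a_N): a_1,\dots,a_N>0\}$ (this set does not depend on the choice). Then $Fl_n^{\ge0}$ is the closure in $Fl_n$ (Euclidean topology) of the set of flags represented by matrices in $U^+_{>0}$. *)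

theory Defs
  imports "Jordan_Normal_Form.Determinant" "Jordan_Normal_Form.DL_Submatrix"
          "HOL-Combinatorics.Transposition"
begin

(* Conventions: indices are 0-based, so [n] = {1..n} is rendered as {0..<n};
   rows/columns of an n x n matrix are 0..n-1; s_i (0 <= i < n-1) swaps i and i+1. *)

definition GL :: "nat \<Rightarrow> real mat set" where
  "GL n = {M \<in> carrier_mat n n. det M \<noteq> 0}"

definition lower_tri_inv :: "nat \<Rightarrow> real mat set" where
  "lower_tri_inv n = {L \<in> GL n. \<forall>i<n. \<forall>j<n. i < j \<longrightarrow> L $$ (i,j) = 0}"

definition flag_of :: "nat \<Rightarrow> real mat \<Rightarrow> real mat set" where
  "flag_of n M = {N. \<exists>L \<in> lower_tri_inv n. N = L * M}"

definition Fl :: "nat \<Rightarrow> real mat set set" where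
  "Fl n = flag_of n ` GL n"

definition GL_open :: "nat \<Rightarrow> real mat set \<Rightarrow> bool" where
  "GL_open n S \<longleftrightarrow> S \<subseteq> GL n \<and>
     (\<forall>M \<in> S. \<exists>e>0. \<forall>N \<in> GL n.
        (\<forall>i<n. \<forall>j<n. \<bar>N $$ (i,j) - M $$ (i,j)\<bar> < e) \<longrightarrow> N \<in> S)"

definition Fl_open :: "nat \<Rightarrow> real mat set set \<Rightarrow> bool" where
  "Fl_open n U \<longleftrightarrow> U \<subseteq> Fl n \<and> GL_open n {M \<in> GL n. flag_of n M \<in> U}"

definition Fl_closure :: "nat \<Rightarrow> real mat set set \<Rightarrow> real mat set set" where
  "Fl_closure n A = {F \<in> Fl n. \<forall>U. Fl_open n U \<and> F \<in> U \<longrightarrow> U \<inter> A \<noteq> {}}"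

definition xmat :: "nat \<Rightarrow> nat \<Rightarrow> real \<Rightarrow> real mat" where
  "xmat n k a = mat n n (\<lambda>(i,j). (if i = j then 1 else 0) + (if i = k \<and> j = Suc k then a else 0))"

definition longest_perm :: "nat \<Rightarrow> nat \<Rightarrow> nat" where
  "longest_perm n = (\<lambda>j. if j < n then n - 1 - j else j)"

definition reduced_word_w0 :: "nat \<Rightarrow> nat list \<Rightarrow> bool" where
  "reduced_word_w0 n ws \<longleftrightarrow> length ws = n choose 2 \<and> (\<forall>i \<in> set ws. Suc i < n) \<and>
     foldr (\<lambda>i f. transpose i (Suc i) \<circ> f) ws id = longest_perm n"

definition U_pos :: "nat \<Rightarrow> nat list \<Rightarrow> real mat set" where
  "U_pos n ws = {foldr (\<lambda>(i,a) M. xmat n i a * M) (zip ws as) (1\<^sub>m n) | as.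
      length as = length ws \<and> (\<forall>a \<in> set as. a > 0)}"

definition Fl_tnn :: "nat \<Rightarrow> nat list \<Rightarrow> real mat set set" where
  "Fl_tnn n ws = Fl_closure n (flag_of n ` U_pos n ws)"

definition plucker :: "real mat \<Rightarrow> nat set \<Rightarrow> real" where
  "plucker M I = det (submatrix M {0..<card I} I)"

end

theory Submission
  imports Defs
begin

text \<open>Matrices in U_pos have non-negative flag minors, since multiplying by a generator on the right
  adds a non-negative multiple of a column to its neighbour. Left multiplication by a lower triangular
  matrix rescales all Pluecker coordinates of one size by a common factor, so ``two coordinates of the
  same size have opposite signs'' is an open condition on flags, which no flag in the closure satisfies;
  a diagonal sign matrix then makes all coordinates non-negative.

  Conversely, adding small multiples of columns to neighbouring columns keeps the coordinates
  non-negative and enlarges the set of the positive ones until all are positive. A matrix all of whose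
  flag minors are positive is reduced by Neville elimination to a lower triangular one, which exhibits
  its flag as a point of U_pos for one particular reduced word of the longest permutation. Matsumoto's
  theorem and the braid relations for the generators show that U_pos is the same for every reduced
  word.\<close>

section \<open>Reduced words\<close>

definition inversions :: "nat \<Rightarrow> (nat \<Rightarrow> nat) \<Rightarrow> (nat \<times> nat) set" where
  "inversions n g = {(a, b). a < b \<and> b < n \<and> g b < g a}"

lemma finite_inversions [simp]: "finite (inversions n g)"
  by (rule finite_subset[of _ "{..<n} \<times> {..<n}"]) (auto simp: inversions_def)

lemma inversions_id [simp]: "inversions n id = {}"
  by (auto simp: inversions_def)

text \<open>No third number lies between \<open>i\<close> and \<open>Suc i\<close>, so exchanging
  these two can reverse the order of that pair only.\<close>

lemma adjacent_transpose_less: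
  assumes "a < b" "(a, b) \<noteq> (i, Suc i)"
  shows "transpose i (Suc i) a < transpose i (Suc i) b"
  using assms by (auto simp: transpose_def)

lemma adjacent_transpose_bound:
  assumes "Suc i < n" "a < n"
  shows "transpose i (Suc i) a < n"
  using assms by (auto simp: transpose_def)

lemma adjacent_transpose_commute:
  assumes "Suc i < j"
  shows "transpose i (Suc i) \<circ> transpose j (Suc j) = transpose j (Suc j) \<circ> transpose i (Suc i)"
proof
  fix x
  consider "x = i" | "x = Suc i" | "x = j" | "x = Suc j" | "x \<notin> {i, Suc i, j, Suc j}" by auto
  then show "(transpose i (Suc i) \<circ> transpose j (Suc j)) x =
      (transpose j (Suc j) \<circ> transpose i (Suc i)) x"
    using assms by cases auto
qed

lemma adjacent_transpose_braid:
  "transpose i (Suc i) \<circ> transpose (Suc i) (Suc (Suc i)) \<circ> transpose i (Suc i) =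
   transpose (Suc i) (Suc (Suc i)) \<circ> transpose i (Suc i) \<circ> transpose (Suc i) (Suc (Suc i))"
    (is "?l = ?r")
proof
  fix x
  consider "x = i" | "x = Suc i" | "x = Suc (Suc i)" | "x \<notin> {i, Suc i, Suc (Suc i)}" by auto
  then show "?l x = ?r x" by cases auto
qed

text \<open>Applying the transposition to both positions matches the inversions of the composite
  with those of \<open>g\<close> other than \<open>(i, Suc i)\<close>, because every other pair
  keeps its order by \<open>adjacent_transpose_less\<close>.\<close>

lemma card_inversions_descent:
  assumes "Suc i < n" "g (Suc i) < g i"
  shows "card (inversions n g) = Suc (card (inversions n (g \<circ> transpose i (Suc i))))"
proof -
  let ?s = "transpose i (Suc i)"
  let ?A = "inversions n (g \<circ> ?s)"
  have "inversions n g = insert (i, Suc i) (map_prod ?s ?s ` ?A)"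
  proof (intro equalityI subsetI)
    fix x assume x: "x \<in> inversions n g"
    obtain a b where ab: "x = (a, b)" by force
    show "x \<in> insert (i, Suc i) (map_prod ?s ?s ` ?A)"
    proof (cases "x = (i, Suc i)")
      case False
      with x ab assms adjacent_transpose_less[of a b i] adjacent_transpose_bound[of i n b]
      have "(?s a, ?s b) \<in> ?A" by (auto simp: inversions_def)
      then have "map_prod ?s ?s (?s a, ?s b) \<in> map_prod ?s ?s ` ?A" by (rule imageI)
      then show ?thesis using ab by simp
    qed simp
  next
    fix x assume "x \<in> insert (i, Suc i) (map_prod ?s ?s ` ?A)"
    then consider "x = (i, Suc i)" | a b where "x = (?s a, ?s b)" "(a, b) \<in> ?A" by auto
    then show "x \<in> inversions n g"
    proof cases
      case 1
      then show ?thesis using assms by (auto simp: inversions_def)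
    next
      case 2
      then have "(a, b) \<noteq> (i, Suc i)" using assms by (auto simp: inversions_def)
      then show ?thesis
        using 2 assms adjacent_transpose_less[of a b i] adjacent_transpose_bound[of i n b]
        by (auto simp: inversions_def)
    qed
  qed
  moreover have "(i, Suc i) \<notin> map_prod ?s ?s ` ?A"
    by (auto simp: inversions_def transpose_def split: if_splits)
  moreover have "card (map_prod ?s ?s ` ?A) = card ?A"
    by (rule card_image, rule inj_on_subset[OF prod.inj_map[OF inj_transpose inj_transpose]]) simp
  ultimately show ?thesis by simp
qed

lemma card_inversions_ascent:
  assumes "Suc i < n" "g i < g (Suc i)"
  shows "card (inversions n (g \<circ> transpose i (Suc i))) = Suc (card (inversions n g))"
  using card_inversions_descent[of i n "g \<circ> transpose i (Suc i)"] assms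
  by (simp add: o_assoc[symmetric])

text \<open>The inverse of the permutation spelled by a word: prepending a letter then acts on positions,
  where inversions are easy to count.\<close>

definition word_inv :: "nat list \<Rightarrow> nat \<Rightarrow> nat" where
  "word_inv ws = foldr (\<lambda>i g. g \<circ> transpose i (Suc i)) ws id"

lemma word_inv_simps [simp]:
  "word_inv [] = id"
  "word_inv (i # ws) = word_inv ws \<circ> transpose i (Suc i)"
  by (simp_all add: word_inv_def)

lemma bij_word_inv: "bij (word_inv ws)"
proof (induction ws)
  case Nil
  have "bij (word_inv [])" by simp
  then show ?case .
next
  case (Cons i ws)
  then have "bij (word_inv (i # ws))" by (simp add: bij_comp)
  then show ?case .
qed

lemma word_inv_neq: "word_inv ws i \<noteq> word_inv ws (Suc i)"
  using bij_is_inj[OF bij_word_inv[of ws]] by (metis injD n_not_Suc_n)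

text \<open>Reducedness is read off from inversions instead of being minimality among all words of
  the same permutation. \<open>card_inversions_word_inv\<close> shows that the inversion count is a
  lower bound for the length.\<close>

definition reduced :: "nat \<Rightarrow> nat list \<Rightarrow> bool" where
  "reduced n ws \<longleftrightarrow> (\<forall>i\<in>set ws. Suc i < n) \<and> card (inversions n (word_inv ws)) = length ws"

lemma card_inversions_word_inv:
  assumes "\<forall>i\<in>set ws. Suc i < n"
  shows "card (inversions n (word_inv ws)) \<le> length ws"
  using assms
proof (induction ws)
  case Nil
  have "card (inversions n (word_inv [])) \<le> length ([] :: nat list)" by simp
  then show ?case .
next
  case (Cons i ws)
  consider "word_inv ws i < word_inv ws (Suc i)" | "word_inv ws (Suc i) < word_inv ws i"
    using word_inv_neq[of ws i] by linarith
  then have "card (inversions n (word_inv (i # ws))) \<le> Suc (card (inversions n (word_inv ws)))"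
    using Cons.prems card_inversions_ascent[of i n "word_inv ws"]
      card_inversions_descent[of i n "word_inv ws"]
    by cases auto
  also have "\<dots> \<le> length (i # ws)" using Cons by simp
  finally show ?case .
qed

text \<open>Each letter changes the inversion count by exactly one. If the first letter lowered it,
  the tail would have more inversions than letters, against
  \<open>card_inversions_word_inv\<close>.\<close>

lemma reduced_ConsD:
  assumes "reduced n (i # ws)"
  shows "reduced n ws" "Suc i < n" "word_inv (i # ws) (Suc i) < word_inv (i # ws) i"
proof -
  show i: "Suc i < n" using assms by (simp add: reduced_def)
  have w: "\<forall>i\<in>set ws. Suc i < n" using assms by (simp add: reduced_def)
  have c: "card (inversions n (word_inv ws \<circ> transpose i (Suc i))) = Suc (length ws)"
    using assms by (simp add: reduced_def)
  have asc: "word_inv ws i < word_inv ws (Suc i)"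
  proof (rule ccontr)
    assume "\<not> ?thesis"
    then have "word_inv ws (Suc i) < word_inv ws i" using word_inv_neq[of ws i] by linarith
    from card_inversions_descent[OF i this] c card_inversions_word_inv[OF w] show False by simp
  qed
  then show "word_inv (i # ws) (Suc i) < word_inv (i # ws) i" by simp
  from card_inversions_ascent[OF i asc] c w show "reduced n ws" by (simp add: reduced_def)
qed

lemma reduced_ConsI:
  assumes "Suc i < n" "g (Suc i) < g i"
    and "reduced n ws" "word_inv ws = g \<circ> transpose i (Suc i)"
  shows "reduced n (i # ws)" "word_inv (i # ws) = g"
proof -
  show g: "word_inv (i # ws) = g" using assms(4) by (simp add: o_assoc[symmetric])
  show "reduced n (i # ws)"
    using card_inversions_descent[OF assms(1,2)] assms unfolding reduced_def g by simp
qed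

text \<open>Strict increase forces \<open>i \<le> g i\<close> when counting up from 0 and the
  opposite bound when counting down from \<open>n - 1\<close>.\<close>

lemma permutes_no_descent_id:
  fixes g :: "nat \<Rightarrow> nat"
  assumes g: "g permutes {..<n}" and asc: "\<And>i. Suc i < n \<Longrightarrow> g i < g (Suc i)"
  shows "g = id"
proof
  fix x
  have ge: "i \<le> g i" if "i < n" for i
    using that
  proof (induction i)
    case (Suc i)
    then have "i \<le> g i" by simp
    also have "g i < g (Suc i)" using Suc.prems by (rule asc)
    finally show ?case by simp
  qed simp
  have le: "g (n - Suc k) \<le> n - Suc k" if "k < n" for k
    using that
  proof (induction k)
    case 0
    then have "g (n - Suc 0) < n" using permutes_in_image[OF g, of "n - Suc 0"] by simp
    then show ?case by simp
  next
    case (Suc k)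
    have "g (n - Suc (Suc k)) < g (Suc (n - Suc (Suc k)))" using Suc.prems by (intro asc) simp
    also have "Suc (n - Suc (Suc k)) = n - Suc k" using Suc.prems by simp
    finally show ?case using Suc by simp
  qed
  show "g x = id x"
  proof (cases "x < n")
    case True
    then show ?thesis using ge[of x] le[of "n - Suc x"] by simp
  next
    case False
    then show ?thesis using permutes_not_in[OF g] by simp
  qed
qed

lemma permutes_comp_adjacent:
  assumes "g permutes {..<n}" "Suc i < n"
  shows "g \<circ> transpose i (Suc i) permutes {..<n}"
  using assms by (intro permutes_compose[OF permutes_swap_id]) auto

text \<open>Bubble sort: as long as there is a descent, removing it costs exactly one inversion and
  supplies the next letter.\<close>

lemma reduced_word_exists:
  assumes "g permutes {..<n}"
  shows "\<exists>ws. reduced n ws \<and> word_inv ws = g"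
  using assms
proof (induction "card (inversions n g)" arbitrary: g rule: less_induct)
  case less
  show ?case
  proof (cases "\<exists>i. Suc i < n \<and> g (Suc i) < g i")
    case True
    then obtain i where i: "Suc i < n" "g (Suc i) < g i" by auto
    obtain ws where "reduced n ws" "word_inv ws = g \<circ> transpose i (Suc i)"
      using less.hyps[of "g \<circ> transpose i (Suc i)"] card_inversions_descent[OF i]
        permutes_comp_adjacent[OF less.prems i(1)] by auto
    with reduced_ConsI[OF i] show ?thesis by blast
  next
    case False
    have "g i < g (Suc i)" if "Suc i < n" for i
    proof -
      have "g i \<noteq> g (Suc i)" using permutes_inj[OF less.prems] by (metis injD n_not_Suc_n)
      then show ?thesis using False that by (meson linorder_neqE_nat)
    qed
    then have "g = id" by (rule permutes_no_descent_id[OF less.prems])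
    then show ?thesis by (intro exI[of _ "[]"]) (simp add: reduced_def)
  qed
qed

lemma permutes_word_inv:
  assumes "\<forall>i\<in>set ws. Suc i < n"
  shows "word_inv ws permutes {..<n}"
  using assms
proof (induction ws)
  case Nil
  have "word_inv [] permutes {..<n}" by (simp add: permutes_id)
  then show ?case .
next
  case (Cons i ws)
  then have "word_inv (i # ws) permutes {..<n}" by (simp add: permutes_comp_adjacent)
  then show ?case .
qed

text \<open>Matsumoto's theorem, by induction on the length: if two reduced words of the same permutation
  start with different letters, the permutation has a reduced word starting with the longest word in
  these two letters.\<close>

lemma reduced_words_braid_invariant:
  fixes U :: "nat list \<Rightarrow> 'a"
  assumes cong: "\<And>i ws vs. U ws = U vs \<Longrightarrow> U (i # ws) = U (i # vs)"
    and comm: "\<And>i j ws. Suc i < j \<Longrightarrow> Suc j < n \<Longrightarrow> U (i # j # ws) = U (j # i # ws)"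
    and braid: "\<And>i ws. Suc (Suc i) < n \<Longrightarrow>
      U (i # Suc i # i # ws) = U (Suc i # i # Suc i # ws)"
    and "reduced n ws" "reduced n vs" "word_inv ws = word_inv vs"
  shows "U ws = U vs"
  using assms(4-6)
proof (induction "length ws" arbitrary: ws vs rule: less_induct)
  case less
  have len: "length vs = length ws" using less.prems unfolding reduced_def by metis
  show ?case
  proof (cases ws)
    case Nil
    then show ?thesis using len by simp
  next
    case (Cons i ws')
    then obtain j vs' where vs: "vs = j # vs'" using len by (cases vs) auto
    \<comment> \<open>The case of distinct first letters, stated with the smaller letter on the
      left; the opposite order follows by symmetry.\<close>
    have key: "U (p # xs) = U (q # ys)"
      if pq: "p < q" and len: "length xs < length ws" "length ys < length ws"
        and r: "reduced n (p # xs)" "reduced n (q # ys)"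
        and e: "word_inv (p # xs) = word_inv (q # ys)" for p q xs ys
    proof -
      define g where "g = word_inv (p # xs)"
      have g: "g permutes {..<n}" unfolding g_def
        by (rule permutes_word_inv) (use r in \<open>simp add: reduced_def\<close>)
      have gxs: "word_inv xs = g \<circ> transpose p (Suc p)"
        by (simp add: g_def o_assoc[symmetric])
      have gys: "word_inv ys = g \<circ> transpose q (Suc q)"
        using e by (simp add: g_def o_assoc[symmetric])
      note px = reduced_ConsD[OF r(1), folded g_def] and qy = reduced_ConsD[OF r(2), folded e g_def]
      show ?thesis
      proof (cases "Suc p < q")
        case True
        \<comment> \<open>The permutation has descents at both \<open>p\<close> and
          \<open>q\<close>, and these involve disjoint pairs of positions, so both letters can be
          stripped in either order. The words \<open>q # us\<close> and \<open>p # us\<close> then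
          link \<open>xs\<close> and \<open>ys\<close> through the induction hypothesis.\<close>
        obtain us where us: "reduced n us"
            "word_inv us = g \<circ> transpose p (Suc p) \<circ> transpose q (Suc q)"
          using reduced_word_exists[OF permutes_comp_adjacent[OF permutes_comp_adjacent[OF g px(2)] qy(2)]]
          by blast
        have us': "word_inv us = g \<circ> transpose q (Suc q) \<circ> transpose p (Suc p)"
          using us(2) adjacent_transpose_commute[OF True] by (simp add: o_assoc[symmetric])
        have 1: "reduced n (q # us)" "word_inv (q # us) = g \<circ> transpose p (Suc p)"
          using reduced_ConsI[OF qy(2) _ us] qy True by simp_all
        have 2: "reduced n (p # us)" "word_inv (p # us) = g \<circ> transpose q (Suc q)"
          using reduced_ConsI[OF px(2) _ us(1) us'] px True by simp_all
        have "U xs = U (q # us)"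
          by (rule less.hyps[OF len(1) px(1) 1(1)]) (simp only: gxs 1(2))
        moreover have "U ys = U (p # us)"
          by (rule less.hyps[OF len(2) qy(1) 2(1)]) (simp only: gys 2(2))
        ultimately show ?thesis
          using comm[OF True qy(2), of us] cong[of xs "q # us" p] cong[of ys "p # us" q] by simp
      next
        case False
        then have q: "q = Suc p" using pq by simp
        let ?s = "transpose p (Suc p)" and ?t = "transpose (Suc p) (Suc (Suc p))"
        \<comment> \<open>Here \<open>g\<close> decreases along \<open>p\<close>,
          \<open>p + 1\<close>, \<open>p + 2\<close>. All three inversions among these positions can
          be removed, in either of the two orders related by the braid relation.\<close>
        obtain us where us: "reduced n us" "word_inv us = g \<circ> ?s \<circ> ?t \<circ> ?s"
          using reduced_word_exists[OF permutes_comp_adjacent[OF permutes_comp_adjacent[OF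
              permutes_comp_adjacent[OF g px(2)] qy(2)] px(2)]] unfolding q by blast
        have us': "word_inv us = g \<circ> ?t \<circ> ?s \<circ> ?t"
          using us(2) adjacent_transpose_braid[of p] by (simp add: o_assoc[symmetric])
        have lt: "g (Suc (Suc p)) < g (Suc p)" "g (Suc p) < g p" "Suc (Suc p) < n" "Suc p < n"
          using px qy q by auto
        have 1: "reduced n (p # us)" "word_inv (p # us) = g \<circ> ?s \<circ> ?t"
          using reduced_ConsI[OF lt(4) _ us] lt by simp_all
        have 11: "reduced n (Suc p # p # us)" "word_inv (Suc p # p # us) = g \<circ> ?s"
          using reduced_ConsI[OF lt(3) _ 1] lt by simp_all
        have 2: "reduced n (Suc p # us)" "word_inv (Suc p # us) = g \<circ> ?t \<circ> ?s"
          using reduced_ConsI[OF lt(3) _ us(1) us'] lt by simp_all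
        have 22: "reduced n (p # Suc p # us)" "word_inv (p # Suc p # us) = g \<circ> ?t"
          using reduced_ConsI[OF lt(4) _ 2] lt by simp_all
        have "U xs = U (Suc p # p # us)"
          by (rule less.hyps[OF len(1) px(1) 11(1)]) (simp only: gxs 11(2))
        moreover have "U ys = U (p # Suc p # us)"
          by (rule less.hyps[OF len(2) qy(1) 22(1)]) (simp only: gys 22(2) q)
        ultimately show ?thesis
          using braid[OF lt(3), of us] cong[of xs "Suc p # p # us" p] cong[of ys "p # Suc p # us" q] q
          by simp
      qed
    qed
    have len': "length ws' < length ws" "length vs' < length ws" using len by (simp_all add: Cons vs)
    note prems = less.prems[unfolded Cons vs]
    consider "i = j" | "i < j" | "j < i" by linarith
    then show ?thesis
    proof cases
      case 1
      have "word_inv ws' = word_inv ws \<circ> transpose i (Suc i)" by (simp add: Cons o_assoc[symmetric])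
      also have "\<dots> = word_inv vs \<circ> transpose i (Suc i)" by (simp only: less.prems(3))
      also have "\<dots> = word_inv vs'" by (simp add: vs 1 o_assoc[symmetric])
      finally have "word_inv ws' = word_inv vs'" .
      moreover have "reduced n ws'" "reduced n vs'"
        using less.prems(1,2) reduced_ConsD(1) unfolding Cons vs by blast+
      ultimately have "U ws' = U vs'" using less.hyps[of ws' vs'] Cons by simp
      then show ?thesis unfolding Cons vs 1 by (rule cong)
    next
      case 2
      then show ?thesis
        unfolding Cons vs by (rule key[OF _ len' prems])
    next
      case 3
      then show ?thesis
        unfolding Cons vs by (rule key[OF _ len'(2,1) prems(2,1) prems(3)[symmetric], symmetric])
    qed
  qed
qed

section \<open>The longest permutation and one particular reduced word for it\<close>

definition word_perm :: "nat list \<Rightarrow> nat \<Rightarrow> nat" where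
  "word_perm ws = foldr (\<lambda>i f. transpose i (Suc i) \<circ> f) ws id"

lemma word_perm_simps [simp]:
  "word_perm [] = id"
  "word_perm (i # ws) = transpose i (Suc i) \<circ> word_perm ws"
  by (simp_all add: word_perm_def)

lemma word_perm_append: "word_perm (xs @ ys) x = word_perm xs (word_perm ys x)"
  by (induction xs) auto

text \<open>Passes from the order of composition in \<open>reduced_word_w0\<close> to that of
  \<open>word_inv\<close>, on which \<open>reduced\<close> is based.\<close>

lemma word_inv_word_perm: "word_inv ws (word_perm ws x) = x"
  by (induction ws) auto

lemma card_ordered_pairs: "card {(a, b). a < b \<and> b < n} = n choose 2" for n :: nat
proof (induction n)
  case (Suc n)
  have "{(a, b). a < b \<and> b < Suc n} = {(a, b). a < b \<and> b < n} \<union> (\<lambda>a. (a, n)) ` {..<n}"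
    by auto
  moreover have "finite {(a, b). a < b \<and> b < n}"
    by (rule finite_subset[of _ "{..<n} \<times> {..<n}"]) auto
  moreover have "card ((\<lambda>a. (a, n)) ` {..<n}) = n"
    by (subst card_image) (auto simp: inj_on_def)
  ultimately show ?case
    using Suc by (subst \<open>_ = _ \<union> _\<close>, subst card_Un_disjoint) (auto simp: numeral_2_eq_2)
qed simp

lemma longest_perm_involution: "longest_perm n (longest_perm n x) = x"
  by (auto simp: longest_perm_def)

text \<open>The longest permutation is its own inverse and inverts every pair of positions, so its
  inversion count is the prescribed length \<open>n choose 2\<close>.\<close>

lemma reduced_word_w0_reduced:
  assumes "reduced_word_w0 n ws"
  shows "reduced n ws" "word_inv ws = longest_perm n"
proof -
  have w: "word_perm ws = longest_perm n" "length ws = n choose 2" "\<forall>i\<in>set ws. Suc i < n"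
    using assms unfolding reduced_word_w0_def word_perm_def by auto
  show e: "word_inv ws = longest_perm n"
  proof
    fix x
    show "word_inv ws x = longest_perm n x"
      using word_inv_word_perm[of ws "longest_perm n x"] by (simp add: w longest_perm_involution)
  qed
  have "inversions n (longest_perm n) = {(a, b). a < b \<and> b < n}"
    by (auto simp: inversions_def longest_perm_def)
  then show "reduced n ws" unfolding reduced_def e using w card_ordered_pairs by simp
qed

text \<open>The word is shaped by Neville elimination: each appended block of consecutive letters
  corresponds to the clearing of one row in \<open>lower_U_pos_factorization\<close>. The word for
  \<open>d\<close> reverses the last \<open>d\<close> positions.\<close>

primrec std_word :: "nat \<Rightarrow> nat \<Rightarrow> nat list" where
  "std_word n 0 = []"
| "std_word n (Suc d) = std_word n d @ [n - Suc d..<n - 1]"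

lemma word_perm_upt:
  assumes "m \<le> p"
  shows "word_perm [m..<p] x = (if m \<le> x \<and> x < p then Suc x else if x = p then m else x)"
  using assms
proof (induction "p - m" arbitrary: m)
  case 0
  then show ?case by auto
next
  case (Suc d)
  then have "word_perm [Suc m..<p] x = (if Suc m \<le> x \<and> x < p then Suc x else if x = p then Suc m else x)"
    by simp
  moreover have "[m..<p] = m # [Suc m..<p]" using Suc by (simp add: upt_conv_Cons)
  ultimately show ?case using Suc by (auto simp: transpose_def)
qed

lemma word_perm_std_word:
  assumes "d \<le> n"
  shows "word_perm (std_word n d) x = (if n - d \<le> x \<and> x < n then (n - d) + (n - 1) - x else x)"
  using assms
proof (induction d arbitrary: x)
  case 0
  then show ?case by auto
next
  case (Suc d)
  then show ?case by (auto simp: word_perm_append word_perm_upt)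
qed

lemma set_std_word: "d \<le> n \<Longrightarrow> \<forall>i\<in>set (std_word n d). Suc i < n"
  by (induction d) auto

lemma length_std_word: "d \<le> n \<Longrightarrow> length (std_word n d) = d choose 2"
  by (induction d) (auto simp: numeral_2_eq_2)

lemma reduced_word_w0_std_word: "reduced_word_w0 n (std_word n n)"
proof -
  have "word_perm (std_word n n) = longest_perm n"
    by (rule ext) (simp add: word_perm_std_word longest_perm_def)
  then show ?thesis
    using set_std_word[of n n] length_std_word[of n n]
    unfolding reduced_word_w0_def word_perm_def by auto
qed

section \<open>Products of the generators\<close>

lemma xmat_eq_addrow_mat: "Suc k < n \<Longrightarrow> xmat n k a = addrow_mat n a k (Suc k)"
  by (rule eq_matI) (auto simp: xmat_def)

lemma xmat_carrier [simp]: "xmat n k a \<in> carrier_mat n n"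
  by (simp add: xmat_def)

lemma xmat_mult: "M \<in> carrier_mat n n \<Longrightarrow> Suc k < n \<Longrightarrow> xmat n k a * M = addrow a k (Suc k) M"
  by (simp add: xmat_eq_addrow_mat addrow_mat[symmetric])

lemma mult_xmat: "M \<in> carrier_mat n n \<Longrightarrow> Suc k < n \<Longrightarrow> M * xmat n k a = addcol a (Suc k) k M"
  by (simp add: xmat_eq_addrow_mat addcol_mat[symmetric])

lemma U_pos_Nil [simp]: "U_pos n [] = {1\<^sub>m n}"
  by (auto simp: U_pos_def)

lemma U_pos_Cons: "U_pos n (i # ws) = {xmat n i a * M | a M. a > 0 \<and> M \<in> U_pos n ws}"
proof (intro equalityI subsetI)
  fix x assume "x \<in> U_pos n (i # ws)"
  then obtain as where as: "length as = Suc (length ws)" "\<forall>a\<in>set as. a > 0"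
    "x = foldr (\<lambda>(i, a) M. xmat n i a * M) (zip (i # ws) as) (1\<^sub>m n)"
    by (auto simp: U_pos_def)
  then obtain a as' where "as = a # as'" by (cases as) auto
  with as show "x \<in> {xmat n i a * M | a M. a > 0 \<and> M \<in> U_pos n ws}"
    unfolding U_pos_def by auto
next
  fix x assume "x \<in> {xmat n i a * M | a M. a > 0 \<and> M \<in> U_pos n ws}"
  then obtain a as where "a > 0" "length as = length ws" "\<forall>a\<in>set as. a > 0"
    "x = xmat n i a * foldr (\<lambda>(i, a) M. xmat n i a * M) (zip ws as) (1\<^sub>m n)"
    unfolding U_pos_def by auto
  then show "x \<in> U_pos n (i # ws)"
    unfolding U_pos_def by (auto intro!: exI[of _ "a # as"])
qed

lemma U_pos_ConsI: "a > 0 \<Longrightarrow> M \<in> U_pos n ws \<Longrightarrow> xmat n i a * M \<in> U_pos n (i # ws)"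
  by (auto simp: U_pos_Cons)

lemma U_pos_ConsE:
  assumes "X \<in> U_pos n (i # ws)"
  obtains a M where "a > 0" "M \<in> U_pos n ws" "X = xmat n i a * M"
  using assms by (auto simp: U_pos_Cons)

lemma U_pos_carrier: "M \<in> U_pos n ws \<Longrightarrow> M \<in> carrier_mat n n"
  by (induction ws arbitrary: M)
    (auto elim!: U_pos_ConsE intro: mult_carrier_mat[OF xmat_carrier])

lemma U_pos_append:
  assumes "A \<in> U_pos n ws" "B \<in> U_pos n vs"
  shows "A * B \<in> U_pos n (ws @ vs)"
  using assms
proof (induction ws arbitrary: A)
  case Nil
  then show ?case using U_pos_carrier[of B n vs] by simp
next
  case (Cons i ws)
  then obtain a M where M: "a > 0" "M \<in> U_pos n ws" "A = xmat n i a * M"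
    by (auto elim: U_pos_ConsE)
  have "A * B = xmat n i a * (M * B)"
    unfolding M(3)
    by (rule assoc_mult_mat[OF xmat_carrier U_pos_carrier[OF M(2)] U_pos_carrier[OF Cons.prems(2)]])
  then show ?case using U_pos_ConsI[OF M(1) Cons.IH[OF M(2) Cons.prems(2)]] by simp
qed

section \<open>Commutation and braid relations for the generators\<close>

lemma U_pos_commute_subset:
  assumes "Suc i < j \<or> Suc j < i" "Suc i < n" "Suc j < n"
  shows "U_pos n (i # j # ws) \<subseteq> U_pos n (j # i # ws)"
proof
  fix X assume "X \<in> U_pos n (i # j # ws)"
  then obtain a b M where X: "a > 0" "b > 0" "M \<in> U_pos n ws" "X = xmat n i a * (xmat n j b * M)"
    by (auto elim!: U_pos_ConsE)
  note M = U_pos_carrier[OF X(3)]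
  \<comment> \<open>Neither row operation reads a row that the other one changes.\<close>
  have "X = xmat n j b * (xmat n i a * M)"
    unfolding X(4) by (rule eq_matI) (use M assms in \<open>auto simp: xmat_mult\<close>)
  then show "X \<in> U_pos n (j # i # ws)" using X by (simp add: U_pos_ConsI)
qed

text \<open>For neighbouring \<open>i\<close> and \<open>j\<close>, the parameters
  \<open>(a, b, c)\<close> of the word \<open>i j i\<close> become
  \<open>(bc/(a+c), a+c, ab/(a+c))\<close> for \<open>j i j\<close>, and positivity is
  preserved.\<close>

lemma U_pos_braid_subset:
  assumes ij: "j = Suc i \<or> i = Suc j" "Suc i < n" "Suc j < n"
  shows "U_pos n (i # j # i # ws) \<subseteq> U_pos n (j # i # j # ws)"
proof
  fix X assume "X \<in> U_pos n (i # j # i # ws)"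
  then obtain a b c M where X: "a > 0" "b > 0" "c > 0" "M \<in> U_pos n ws"
    "X = xmat n i a * (xmat n j b * (xmat n i c * M))"
    by (auto elim!: U_pos_ConsE)
  note M = U_pos_carrier[OF X(4)]
  define p q where "p = b * c / (a + c)" and "q = a * b / (a + c)"
  have pq: "p > 0" "q > 0" using X by (simp_all add: p_def q_def)
  have "p + q = b * (a + c) / (a + c)"
    by (simp add: p_def q_def add_divide_distrib distrib_left mult.commute)
  then have b: "b = p + q" using X by simp
  \<comment> \<open>Together with \<open>b = p + q\<close> this is all that equality of the two
    products requires: it matches the coefficients that involve two parameters.\<close>
  have "a * p = c * q" by (simp add: p_def q_def)
  then have comm: "a * (p * m) = c * (q * m)" for m by (metis mult.assoc)
  have "X = xmat n j p * (xmat n i (a + c) * (xmat n j q * M))"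
    unfolding X(5) b
    by (rule eq_matI) (use M ij in \<open>auto simp: xmat_mult algebra_simps comm\<close>)
  then show "X \<in> U_pos n (j # i # j # ws)" using X pq by (simp add: U_pos_ConsI)
qed

lemma U_pos_reduced_word_w0:
  assumes "reduced_word_w0 n ws" "reduced_word_w0 n vs"
  shows "U_pos n ws = U_pos n vs"
proof (rule reduced_words_braid_invariant[where n = n])
  show "U_pos n (i # j # ws) = U_pos n (j # i # ws)" if "Suc i < j" "Suc j < n" for i j ws
    using that by (intro equalityI U_pos_commute_subset) auto
  show "U_pos n (i # Suc i # i # ws) = U_pos n (Suc i # i # Suc i # ws)"
    if "Suc (Suc i) < n" for i ws
    using that by (intro equalityI U_pos_braid_subset) auto
qed (use assms reduced_word_w0_reduced in \<open>auto simp: U_pos_Cons\<close>)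

section \<open>Pluecker coordinates under column operations\<close>

text \<open>Exactly \<open>b\<close> elements of \<open>I\<close> lie below \<open>f b\<close>. This
  allows a column set to be listed by whichever increasing map is convenient.\<close>

lemma pick_eq:
  assumes f: "strict_mono_on {..<k} f" "f ` {..<k} = I" and b: "b < k"
  shows "pick I b = f b"
proof -
  have less: "f a < f b \<longleftrightarrow> a < b" if "a < k" for a
    using strict_mono_on_less[OF f(1)] b that by simp
  have "{a \<in> I. a < f b} = f ` {..<b}"
  proof (intro equalityI subsetI)
    fix x assume "x \<in> {a \<in> I. a < f b}"
    then obtain a where "a < k" "x = f a" "f a < f b" using f(2) by blast
    then show "x \<in> f ` {..<b}" using less by blast
  next
    fix x assume "x \<in> f ` {..<b}"
    then obtain a where "a < b" "x = f a" by blast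
    then show "x \<in> {a \<in> I. a < f b}" using less[of a] f(2) b by auto
  qed
  moreover have "inj_on f {..<b}"
    by (rule inj_on_subset[OF strict_mono_on_imp_inj_on[OF f(1)]]) (use b in auto)
  then have "card (f ` {..<b}) = b" by (simp add: card_image)
  moreover have "f b \<in> I" using f(2) b by blast
  ultimately show ?thesis using pick_card_in_set[of "f b" I] by simp
qed

lemma strict_mono_on_pick: "strict_mono_on {..<card I} (pick I)"
proof (rule strict_mono_onI)
  fix r s assume "r \<in> {..<card I}" "s \<in> {..<card I}" "r < s"
  then show "pick I r < pick I s" by (intro pick_mono_le) simp_all
qed

lemma pick_image:
  assumes "finite I"
  shows "pick I ` {..<card I} = I"
proof (rule card_subset_eq[OF assms])
  show "pick I ` {..<card I} \<subseteq> I" by (auto intro: pick_in_set_le)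
  show "card (pick I ` {..<card I}) = card I"
    by (subst card_image[OF strict_mono_on_imp_inj_on[OF strict_mono_on_pick]]) simp
qed

lemma plucker_eq_det:
  assumes M: "M \<in> carrier_mat n n" and I: "I \<subseteq> {0..<n}"
    and f: "strict_mono_on {..<k} f" "f ` {..<k} = I"
  shows "plucker M I = det (mat k k (\<lambda>(a, b). M $$ (a, f b)))"
proof -
  have k: "card I = k"
    using strict_mono_on_imp_inj_on[OF f(1)] f(2) by (metis card_image card_lessThan)
  have kn: "k \<le> n" using card_mono[OF _ I] k by simp
  have "{i. i < n \<and> i \<in> I} = I" "{i. i < n \<and> i < k} = {..<k}" using I kn by auto
  then have dims: "card {i. i < n \<and> i \<in> I} = k" "card {i. i < n \<and> i \<in> {0..<k}} = k"
    using k by auto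
  have pk: "pick {0..<k} a = a" if "a < k" for a
    using pick_eq[of k "\<lambda>x. x" "{0..<k}"] that by (simp add: strict_mono_on_def lessThan_atLeast0)
  show ?thesis
    unfolding plucker_def k submatrix_def
    by (rule arg_cong[of _ _ det], rule eq_matI)
      (use M dims in \<open>auto simp: pk pick_eq[OF f]\<close>)
qed

text \<open>Expand along column \<open>q\<close>: the cofactors do not see that column, so the three
  matrices share them.\<close>

lemma det_column_linear:
  fixes f g :: "nat \<Rightarrow> nat \<Rightarrow> 'a :: comm_ring_1"
  assumes "q < k" and "\<And>a b. a < k \<Longrightarrow> b < k \<Longrightarrow> b \<noteq> q \<Longrightarrow> f a b = g a b \<and> h a b = g a b"
    and "\<And>a. a < k \<Longrightarrow> h a q = g a q + t * f a q"
  shows "det (mat k k (\<lambda>(a, b). h a b)) =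
    det (mat k k (\<lambda>(a, b). g a b)) + t * det (mat k k (\<lambda>(a, b). f a b))"
proof -
  let ?M = "\<lambda>u. mat k k (\<lambda>(a, b). u a b)"
  have lap: "det (?M u) = (\<Sum>i<k. u i q * cofactor (?M u) i q)" for u :: "nat \<Rightarrow> nat \<Rightarrow> 'a"
    using laplace_expansion_column[of "?M u" k q] assms(1) by simp
  have cof: "cofactor (?M u) i q = cofactor (?M g) i q"
    if "\<And>a b. a < k \<Longrightarrow> b < k \<Longrightarrow> b \<noteq> q \<Longrightarrow> u a b = g a b" "i < k" for u i
  proof -
    have "mat_delete (?M u) i q = mat_delete (?M g) i q"
      by (rule eq_matI) (use that in \<open>auto simp: mat_delete_def\<close>)
    then show ?thesis by (simp only: cofactor_def)
  qed
  have f: "det (?M f) = (\<Sum>i<k. f i q * cofactor (?M g) i q)"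
    unfolding lap by (intro sum.cong refl arg_cong2[of _ _ _ _ "(*)"] cof) (use assms(2) in auto)
  have "det (?M h) = (\<Sum>i<k. (g i q + t * f i q) * cofactor (?M g) i q)"
    unfolding lap by (intro sum.cong refl arg_cong2[of _ _ _ _ "(*)"] cof) (use assms(2,3) in auto)
  also have "\<dots> = (\<Sum>i<k. g i q * cofactor (?M g) i q) + t * (\<Sum>i<k. f i q * cofactor (?M g) i q)"
    by (simp add: distrib_right sum.distrib sum_distrib_left mult.assoc)
  finally show ?thesis unfolding f lap[of g] .
qed

lemma card_exchange:
  assumes "finite I" "p \<in> I" "q \<notin> I"
  shows "card (insert q (I - {p})) = card I"
  using card.remove[OF assms(1,2)] assms by simp

lemma plucker_addcol_outside:
  assumes M: "M \<in> carrier_mat n n" and I: "I \<subseteq> {0..<n}" and "p \<notin> I"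
  shows "plucker (addcol t p q M) I = plucker M I"
proof -
  have fin: "finite I" using I finite_subset by blast
  note f = strict_mono_on_pick[of I] pick_image[OF fin]
  have kn: "card I \<le> n" using card_mono[OF _ I] by simp
  have "pick I b \<in> I" if "b < card I" for b using pick_in_set_le[OF that] .
  then have fn: "pick I b < n" "p \<noteq> pick I b" if "b < card I" for b
    using that I assms(3) by (auto simp: subset_iff)
  have A: "addcol t p q M \<in> carrier_mat n n" using M by (simp add: mat_addcol_def)
  show ?thesis
    unfolding plucker_eq_det[OF M I f] plucker_eq_det[OF A I f]
    by (rule arg_cong[of _ _ det], rule eq_matI) (use M fn kn in \<open>simp_all add: mat_addcol_def\<close>)
qed

text \<open>The determinant is linear in column \<open>p\<close>. The extra term has a repeated
  column if \<open>q\<close> is already in \<open>I\<close>; otherwise \<open>q\<close> takes the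
  place of its neighbour \<open>p\<close> without disturbing the order of the columns, so no sign
  appears.\<close>

lemma plucker_addcol:
  assumes M: "M \<in> carrier_mat n n" and I: "I \<subseteq> {0..<n}" and pI: "p \<in> I"
    and q: "q < n" "p = Suc q \<or> q = Suc p"
  shows "plucker (addcol t p q M) I =
    plucker M I + (if q \<in> I then 0 else t * plucker M (insert q (I - {p})))"
proof -
  have fin: "finite I" using I finite_subset by blast
  define k where "k = card I"
  have kn: "k \<le> n" using card_mono[OF _ I] k_def by simp
  define f where "f = pick I"
  have f: "strict_mono_on {..<k} f" "f ` {..<k} = I"
    using strict_mono_on_pick pick_image[OF fin] by (auto simp: f_def k_def)
  have fn: "f b < n" if "b < k" for b using f(2) I that by auto
  obtain b0 where b0: "b0 < k" "f b0 = p" using f(2) pI by auto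
  have fp: "p = f b \<longleftrightarrow> b = b0" if "b < k" for b
    using strict_mono_on_imp_inj_on[OF f(1)] b0 that by (auto simp: inj_on_def)
  have A: "addcol t p q M \<in> carrier_mat n n" using M by (simp add: mat_addcol_def)
  define g where "g = f(b0 := q)"
  have "plucker (addcol t p q M) I =
      plucker M I + t * det (mat k k (\<lambda>(a, b). M $$ (a, g b)))"
    unfolding plucker_eq_det[OF M I f] plucker_eq_det[OF A I f]
    by (rule det_column_linear[OF b0(1)])
      (use M fn b0(1) kn in \<open>simp_all add: fp mat_addcol_def g_def\<close>)
  moreover have "det (mat k k (\<lambda>(a, b). M $$ (a, g b))) = 0" if "q \<in> I"
  proof -
    have "q \<in> f ` {..<k}" using f(2) that by simp
    then obtain b1 where b1: "b1 < k" "f b1 = q" by auto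
    have "b1 \<noteq> b0" using b0 b1 q by auto
    then show ?thesis
      by (intro det_identical_columns[of _ k b0 b1])
        (use b0 b1 in \<open>auto simp: g_def intro!: eq_vecI\<close>)
  qed
  moreover have "det (mat k k (\<lambda>(a, b). M $$ (a, g b))) = plucker M (insert q (I - {p}))"
    if qI: "q \<notin> I"
  proof (rule plucker_eq_det[symmetric, OF M])
    show "insert q (I - {p}) \<subseteq> {0..<n}" using I q by auto
    show "g ` {..<k} = insert q (I - {p})"
    proof -
      have "f ` ({..<k} - {b0}) = I - {p}"
        using inj_on_image_set_diff[OF strict_mono_on_imp_inj_on[OF f(1)], of "{..<k}" "{b0}"] b0 f(2)
        by auto
      moreover have "g ` {..<k} = insert q (f ` ({..<k} - {b0}))"
        using b0(1) by (auto simp: g_def)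
      ultimately show ?thesis by simp
    qed
    show "strict_mono_on {..<k} g"
    proof (rule strict_mono_onI)
      fix r s assume rs: "r \<in> {..<k}" "s \<in> {..<k}" "r < s"
      have "f r < f s" using strict_mono_onD[OF f(1)] rs by blast
      moreover have "f r \<noteq> q" "f s \<noteq> q" using f(2) rs qI by auto
      ultimately show "g r < g s" using rs b0 q by (auto simp: g_def)
    qed
  qed
  ultimately show ?thesis by auto
qed

text \<open>Descend from the full determinant: expanding a nonzero minor along its last row yields a
  nonzero minor with one row fewer.\<close>

lemma plucker_nonzero_exists:
  assumes M: "M \<in> GL n" and "k \<le> n"
  shows "\<exists>I \<subseteq> {0..<n}. card I = k \<and> plucker M I \<noteq> 0"
  using assms(2)
proof (induction rule: inc_induct)
  case base
  have Mc: "M \<in> carrier_mat n n" and d: "det M \<noteq> 0" using M by (auto simp: GL_def)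
  have "mat n n (\<lambda>(a, b). M $$ (a, b)) = M" using Mc by (auto intro!: eq_matI)
  then have "plucker M {0..<n} = det M"
    using plucker_eq_det[OF Mc, of "{0..<n}" n "\<lambda>x. x"]
    by (simp add: strict_mono_on_def lessThan_atLeast0)
  then show ?case using d by (intro exI[of _ "{0..<n}"]) auto
next
  case (step k)
  have Mc: "M \<in> carrier_mat n n" using M by (auto simp: GL_def)
  obtain I where I: "I \<subseteq> {0..<n}" "card I = Suc k" "plucker M I \<noteq> 0" using step.IH by auto
  have fin: "finite I" using I finite_subset by blast
  define f where "f = pick I"
  have f: "strict_mono_on {..<Suc k} f" "f ` {..<Suc k} = I"
    using strict_mono_on_pick[of I] pick_image[OF fin] I(2) by (auto simp: f_def)
  let ?A = "mat (Suc k) (Suc k) (\<lambda>(a, b). M $$ (a, f b))"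
  have "det ?A = (\<Sum>b<Suc k. ?A $$ (k, b) * cofactor ?A k b)"
    by (rule laplace_expansion_row) auto
  moreover have "det ?A \<noteq> 0" using I(3) plucker_eq_det[OF Mc I(1) f] by simp
  ultimately have "\<exists>b\<in>{..<Suc k}. ?A $$ (k, b) * cofactor ?A k b \<noteq> 0"
    using sum.not_neutral_contains_not_neutral by force
  then obtain b where b: "b < Suc k" "cofactor ?A k b \<noteq> 0" by auto
  \<comment> \<open>Lists the columns that remain after the one at position \<open>b\<close> is
    deleted.\<close>
  define g where "g = (\<lambda>x. f (if x < b then x else Suc x))"
  have del: "mat_delete ?A k b = mat k k (\<lambda>(a, x). M $$ (a, g x))"
    by (rule eq_matI) (use b in \<open>auto simp: mat_delete_def g_def\<close>)
  have "strict_mono_on {..<k} g"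
    unfolding g_def by (rule strict_mono_onI) (use b in \<open>auto intro!: strict_mono_onD[OF f(1)]\<close>)
  moreover have "g ` {..<k} = I - {f b}"
  proof -
    have "(\<lambda>x. if x < b then x else Suc x) ` {..<k} = {..<Suc k} - {b}"
    proof (intro equalityI subsetI)
      fix y assume "y \<in> {..<Suc k} - {b}"
      then show "y \<in> (\<lambda>x. if x < b then x else Suc x) ` {..<k}"
        using b by (cases "y < b") (auto intro: image_eqI[of _ _ y] image_eqI[of _ _ "y - 1"])
    qed (use b in auto)
    then have "g ` {..<k} = f ` ({..<Suc k} - {b})"
      unfolding g_def by (metis image_image)
    also have "\<dots> = I - {f b}"
      using inj_on_image_set_diff[OF strict_mono_on_imp_inj_on[OF f(1)], of "{..<Suc k}" "{b}"] b f(2)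
      by auto
    finally show ?thesis .
  qed
  ultimately have "plucker M (I - {f b}) = det (mat_delete ?A k b)"
    unfolding del using I(1) by (intro plucker_eq_det[OF Mc]) auto
  moreover have "f b \<in> I" using f(2) b by auto
  ultimately show ?case
    using b(2) I fin by (intro exI[of _ "I - {f b}"]) (auto simp: cofactor_def)
qed

lemma initial_segment_or_gap:
  fixes I :: "nat set"
  assumes "finite I"
  shows "I = {0..<card I} \<or> (\<exists>q. q \<notin> I \<and> Suc q \<in> I)"
proof (rule disjCI)
  assume "\<not> (\<exists>q. q \<notin> I \<and> Suc q \<in> I)"
  then have down: "q \<in> I" if "Suc q \<in> I" for q using that by blast
  have seg: "{0..x} \<subseteq> I" if "x \<in> I" for x
    using that
  proof (induction x)
    case (Suc x)
    then have "{0..x} \<subseteq> I" using down by blast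
    then show ?case using Suc.prems by (auto simp: atLeast0_atMost_Suc)
  qed simp
  have "I \<subseteq> {0..<card I}"
  proof
    fix x assume "x \<in> I"
    then have "card {0..x} \<le> card I" using seg assms by (intro card_mono)
    then show "x \<in> {0..<card I}" by simp
  qed
  then show "I = {0..<card I}" by (intro card_subset_eq) auto
qed

text \<open>Subsets of one size are connected by moving a single element to a free neighbouring
  place. Pushing elements down lowers the sum until the initial segment is reached, and every move
  is reversible.\<close>

lemma subset_exchange_connected:
  assumes step: "\<And>I p q. I \<subseteq> {0..<n} \<Longrightarrow> Q I \<Longrightarrow> p \<in> I \<Longrightarrow> q \<notin> I \<Longrightarrow> q < n \<Longrightarrow>
      p = Suc q \<or> q = Suc p \<Longrightarrow> Q (insert q (I - {p}))"
    and I: "I \<subseteq> {0..<n}" "Q I" and J: "J \<subseteq> {0..<n}" "card J = card I"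
  shows "Q J"
proof -
  have "Q I \<longleftrightarrow> Q {0..<card I}" if "I \<subseteq> {0..<n}" for I
    using that
  proof (induction "\<Sum>I" arbitrary: I rule: less_induct)
    case less
    have fin: "finite I" using less.prems finite_subset by blast
    show ?case
    proof (cases "I = {0..<card I}")
      case False
      then obtain q where q: "q \<notin> I" "Suc q \<in> I" using initial_segment_or_gap[OF fin] by auto
      define I' where "I' = insert q (I - {Suc q})"
      have I': "I' \<subseteq> {0..<n}" "q \<in> I'" "Suc q \<notin> I'" "Suc q < n"
        using less.prems q by (auto simp: I'_def)
      have "\<Sum>I = Suc q + \<Sum>(I - {Suc q})" using fin q(2) by (rule sum.remove)
      moreover have "\<Sum>I' = q + \<Sum>(I - {Suc q})" using fin q(1) by (simp add: I'_def)
      ultimately have "\<Sum>I' < \<Sum>I" by simp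
      then have "Q I' \<longleftrightarrow> Q {0..<card I'}" using less.hyps I'(1) by blast
      moreover have "card I' = card I" unfolding I'_def by (rule card_exchange[OF fin q(2,1)])
      moreover have "I = insert (Suc q) (I' - {q})" using q by (auto simp: I'_def)
      then have "Q I' \<longleftrightarrow> Q I"
        using step[of I' q "Suc q"] step[of I "Suc q" q] I' q less.prems by (auto simp: I'_def)
      ultimately show ?thesis by simp
    qed auto
  qed
  then show ?thesis using I J by metis
qed

section \<open>Non-negative coordinates and their perturbation to positive ones\<close>

definition flag_nonneg :: "nat \<Rightarrow> real mat \<Rightarrow> bool" where
  "flag_nonneg n M \<longleftrightarrow> (\<forall>I \<subseteq> {0..<n}. plucker M I \<ge> 0)"

lemma plucker_addcol_ge:
  assumes M: "M \<in> carrier_mat n n" "flag_nonneg n M" and I: "I \<subseteq> {0..<n}"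
    and q: "q < n" "p = Suc q \<or> q = Suc p" and t: "t \<ge> 0"
  shows "plucker M I \<le> plucker (addcol t p q M) I"
proof (cases "p \<in> I")
  case True
  have "insert q (I - {p}) \<subseteq> {0..<n}" using I q by auto
  then have "t * plucker M (insert q (I - {p})) \<ge> 0" using M(2) t by (auto simp: flag_nonneg_def)
  then show ?thesis using plucker_addcol[OF M(1) I True q, of t] by auto
next
  case False
  then show ?thesis using plucker_addcol_outside[OF M(1) I False] by simp
qed

lemma flag_nonneg_addcol:
  assumes "M \<in> carrier_mat n n" "flag_nonneg n M" "q < n" "p = Suc q \<or> q = Suc p" "t \<ge> 0"
  shows "flag_nonneg n (addcol t p q M)"
  using plucker_addcol_ge[OF assms(1,2) _ assms(3-5)] assms(2) order_trans
  unfolding flag_nonneg_def by blast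

text \<open>Induction on the number of vanishing coordinates: one small column operation makes at
  least one of them positive and decreases none.\<close>

lemma flag_positive_approximation:
  assumes "M \<in> GL n" "flag_nonneg n M" "e > 0"
  shows "\<exists>N \<in> GL n. (\<forall>i<n. \<forall>j<n. \<bar>N $$ (i, j) - M $$ (i, j)\<bar> < e) \<and>
    (\<forall>I \<subseteq> {0..<n}. plucker N I > 0)"
  using assms
proof (induction "card {I. I \<subseteq> {0..<n} \<and> plucker M I = 0}" arbitrary: M e rule: less_induct)
  case less
  have Mc: "M \<in> carrier_mat n n" using less.prems by (auto simp: GL_def)
  have nonneg: "plucker M I \<ge> 0" if "I \<subseteq> {0..<n}" for I
    using less.prems(2) that by (auto simp: flag_nonneg_def)
  show ?case
  proof (cases "\<exists>Z \<subseteq> {0..<n}. plucker M Z = 0")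
    case False
    then show ?thesis using less.prems nonneg by (intro bexI[of _ M]) (auto simp: less_le)
  next
    case True
    then obtain Z where Z: "Z \<subseteq> {0..<n}" "plucker M Z = 0" by auto
    have "card Z \<le> n" using card_mono[OF _ Z(1)] by simp
    then obtain J where J: "J \<subseteq> {0..<n}" "card J = card Z" "plucker M J \<noteq> 0"
      using plucker_nonzero_exists[OF less.prems(1)] by blast
    \<comment> \<open>Size \<open>card Z\<close> has both a zero and a nonzero coordinate, so by
      connectedness some single exchange leads from a nonzero one to a zero one.\<close>
    have "\<exists>I p q. I \<subseteq> {0..<n} \<and> plucker M I \<noteq> 0 \<and> p \<in> I \<and> q \<notin> I \<and> q < n \<and>
        (p = Suc q \<or> q = Suc p) \<and> plucker M (insert q (I - {p})) = 0"
    proof (rule ccontr)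
      assume "\<not> ?thesis"
      then have "plucker M Z \<noteq> 0"
        by (intro subset_exchange_connected[where Q = "\<lambda>I. plucker M I \<noteq> 0", OF _ J(1,3) Z(1)])
          (use J in blast, simp add: J)
      then show False using Z by simp
    qed
    then obtain I p q where I: "I \<subseteq> {0..<n}" "plucker M I \<noteq> 0" "p \<in> I" "q \<notin> I" "q < n"
        and pq: "p = Suc q \<or> q = Suc p" and zero: "plucker M (insert q (I - {p})) = 0"
      by blast
    define B where "B = (\<Sum>i<n. \<Sum>j<n. \<bar>M $$ (i, j)\<bar>)"
    have B: "\<bar>M $$ (i, j)\<bar> \<le> B" if "i < n" "j < n" for i j
    proof -
      have "\<bar>M $$ (i, j)\<bar> \<le> (\<Sum>j<n. \<bar>M $$ (i, j)\<bar>)"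
        by (rule member_le_sum) (use that in auto)
      also have "\<dots> \<le> B" unfolding B_def
        by (rule member_le_sum) (use that in \<open>auto intro: sum_nonneg\<close>)
      finally show ?thesis .
    qed
    have "B \<ge> 0" unfolding B_def by (intro sum_nonneg) auto
    then have nz: "1 + B \<noteq> 0" by simp
    \<comment> \<open>Small enough to move each entry by less than \<open>e / 2\<close>; the other
      half is left for the induction hypothesis. The summand 1 keeps the denominator
      positive.\<close>
    define t where "t = e / 2 / (1 + B)"
    have t: "t > 0" using \<open>B \<ge> 0\<close> less.prems(3) by (simp add: t_def)
    have tB: "t * \<bar>M $$ (i, j)\<bar> < e / 2" if "i < n" "j < n" for i j
    proof -
      have "t * \<bar>M $$ (i, j)\<bar> < t * (1 + B)" using B[OF that] t by (intro mult_strict_left_mono) auto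
      also have "\<dots> = e / 2" by (simp only: nonzero_eq_divide_eq[OF nz, symmetric] t_def)
      finally show ?thesis .
    qed
    have pn: "p < n" "p \<noteq> q" using I pq by auto
    define N where "N = addcol t q p M"
    have Nc: "N \<in> carrier_mat n n" using Mc by (simp add: N_def mat_addcol_def)
    have N: "N \<in> GL n" using less.prems(1) Nc det_addcol[OF pn(1) pn(2)[symmetric] Mc, of t]
      by (simp add: GL_def N_def)
    have close: "\<bar>N $$ (i, j) - M $$ (i, j)\<bar> < e / 2" if "i < n" "j < n" for i j
      using tB[OF that(1) pn(1)] Mc that less.prems(3) t by (auto simp: N_def mat_addcol_def abs_mult)
    have qp: "q = Suc p \<or> p = Suc q" using pq by auto
    have Nn: "flag_nonneg n N" unfolding N_def
      by (rule flag_nonneg_addcol[OF Mc less.prems(2) pn(1) qp]) (use t in simp)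
    have ge: "plucker M K \<le> plucker N K" if "K \<subseteq> {0..<n}" for K
      unfolding N_def by (rule plucker_addcol_ge[OF Mc less.prems(2) that pn(1) qp]) (use t in simp)
    let ?I' = "insert q (I - {p})"
    have I': "?I' \<subseteq> {0..<n}" using I by auto
    have "insert p (?I' - {q}) = I" using I by auto
    then have "plucker N ?I' = t * plucker M I"
      using plucker_addcol[OF Mc I' _ pn(1) qp, of t] zero pn by (simp add: N_def)
    then have "plucker N ?I' \<noteq> 0" using t I by simp
    moreover have "plucker M K = 0" if "K \<subseteq> {0..<n}" "plucker N K = 0" for K
      using ge[OF that(1)] nonneg[OF that(1)] that by simp
    ultimately have "{I. I \<subseteq> {0..<n} \<and> plucker N I = 0} \<subset> {I. I \<subseteq> {0..<n} \<and> plucker M I = 0}"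
      using I' zero by blast
    then have "card {I. I \<subseteq> {0..<n} \<and> plucker N I = 0} < card {I. I \<subseteq> {0..<n} \<and> plucker M I = 0}"
      by (intro psubset_card_mono) auto
    from less.hyps[OF this N Nn, of "e / 2"] less.prems(3) obtain N' where N':
      "N' \<in> GL n" "\<And>i j. i < n \<Longrightarrow> j < n \<Longrightarrow> \<bar>N' $$ (i, j) - N $$ (i, j)\<bar> < e / 2"
      "\<forall>I \<subseteq> {0..<n}. plucker N' I > 0" by auto
    have "\<bar>N' $$ (i, j) - M $$ (i, j)\<bar> < e" if "i < n" "j < n" for i j
      using close[OF that] N'(2)[OF that] by arith
    then show ?thesis using N' by blast
  qed
qed

section \<open>Factorization of totally positive flags\<close>

text \<open>An increasing enumeration satisfies \<open>b \<le> f b\<close>, so the selected columns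
  form a lower triangular matrix with diagonal entries 0 or 1.\<close>

lemma flag_nonneg_one: "flag_nonneg n (1\<^sub>m n)"
  unfolding flag_nonneg_def
proof (intro allI impI)
  fix I :: "nat set" assume I: "I \<subseteq> {0..<n}"
  have fin: "finite I" using I finite_subset by blast
  define k where "k = card I"
  define f where "f = pick I"
  have f: "strict_mono_on {..<k} f" "f ` {..<k} = I"
    using strict_mono_on_pick pick_image[OF fin] by (auto simp: f_def k_def)
  have fn: "f b < n" if "b < k" for b using f(2) I that by auto
  have kn: "k \<le> n" using card_mono[OF _ I] k_def by simp
  have ge: "b \<le> f b" if "b < k" for b
    using that
  proof (induction b)
    case (Suc b)
    then have "b \<le> f b" by simp
    also have "f b < f (Suc b)" using strict_mono_onD[OF f(1), of b "Suc b"] Suc.prems by simp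
    finally show ?case by simp
  qed simp
  let ?A = "mat k k (\<lambda>(a, b). (1\<^sub>m n :: real mat) $$ (a, f b))"
  have "plucker (1\<^sub>m n) I = det ?A" by (rule plucker_eq_det[OF _ I f]) simp
  also have "\<dots> = prod_list (diag_mat ?A)"
  proof (rule det_lower_triangular)
    fix i j assume "i < j" "j < k"
    then show "?A $$ (i, j) = 0" using fn[of j] ge[of j] kn by auto
  qed simp
  also have "\<dots> \<ge> 0" unfolding prod_list_diag_prod by (intro prod_nonneg) (use fn kn in auto)
  finally show "0 \<le> plucker (1\<^sub>m n) I" .
qed

text \<open>The left factor \<open>M\<close> is arbitrary so that the generators can be absorbed
  into it one after another as column operations.\<close>

lemma flag_nonneg_mult_U_pos:
  assumes "M \<in> carrier_mat n n" "flag_nonneg n M" "\<forall>i\<in>set ws. Suc i < n" "X \<in> U_pos n ws"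
  shows "flag_nonneg n (M * X)"
  using assms
proof (induction ws arbitrary: M X)
  case (Cons i ws)
  then obtain a Y where Y: "a > 0" "Y \<in> U_pos n ws" "X = xmat n i a * Y"
    by (auto elim: U_pos_ConsE)
  have "M * X = (M * xmat n i a) * Y"
    unfolding Y(3) using assoc_mult_mat[OF Cons.prems(1) xmat_carrier U_pos_carrier[OF Y(2)]] by simp
  moreover have "flag_nonneg n (M * xmat n i a)"
    using flag_nonneg_addcol[OF Cons.prems(1,2), of i "Suc i" a] mult_xmat[OF Cons.prems(1)]
      Cons.prems(3) Y(1) by simp
  ultimately show ?case
    using Cons.IH[OF _ _ _ Y(2), of "M * xmat n i a"] Cons.prems mult_carrier_mat[OF _ xmat_carrier]
    by simp
qed simp

lemma flag_nonneg_U_pos: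
  assumes "\<forall>i\<in>set ws. Suc i < n" "X \<in> U_pos n ws"
  shows "flag_nonneg n X"
  using flag_nonneg_mult_U_pos[OF one_carrier_mat flag_nonneg_one assms] U_pos_carrier[OF assms(2)]
  by simp

text \<open>After the column subtractions the first row vanishes except for its first entry, and
  Laplace expansion leaves one minor.\<close>

lemma det_eliminate_first_row:
  fixes v v' :: "nat \<Rightarrow> nat \<Rightarrow> 'a :: comm_ring_1"
  assumes step: "\<And>a b. a \<le> k \<Longrightarrow> b < k \<Longrightarrow> v' a (Suc b) = v a (Suc b) - c b * v a b"
    and zero: "\<And>b. b < k \<Longrightarrow> v' 0 (Suc b) = 0"
  shows "det (mat (Suc k) (Suc k) (\<lambda>(a, b). v a b)) =
    v 0 0 * det (mat k k (\<lambda>(a, b). v' (Suc a) (Suc b)))"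
proof -
  let ?A = "mat (Suc k) (Suc k) (\<lambda>(a, b). v a b)"
  let ?B = "mat (Suc k) (Suc k) (\<lambda>(a, b). if b = 0 then v a 0 else v' a b)"
  \<comment> \<open>All subtractions use the original columns, so together they are one right
    multiplication by this unipotent bidiagonal matrix.\<close>
  let ?Y = "mat (Suc k) (Suc k) (\<lambda>(i, b). (if i = b then 1 else 0) + (if Suc i = b then - c i else 0))"
  have "det ?Y = prod_list (diag_mat ?Y)" by (rule det_upper_triangular[of _ "Suc k"]) auto
  also have "\<dots> = 1" unfolding prod_list_diag_prod by (intro prod.neutral) simp
  finally have Y: "det ?Y = 1" .
  have "?B = ?A * ?Y"
  proof (rule eq_matI)
    fix a b assume "a < dim_row (?A * ?Y)" "b < dim_col (?A * ?Y)"
    then have ab: "a \<le> k" "b \<le> k" by auto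
    have "(?A * ?Y) $$ (a, b) =
        (\<Sum>i<Suc k. (if i = b then v a i else 0) + (if Suc i = b then - c i * v a i else 0))"
      using ab by (auto simp: scalar_prod_def lessThan_atLeast0 intro!: sum.cong)
    also have "\<dots> = v a b + (if b = 0 then 0 else - c (b - 1) * v a (b - 1))"
      using ab by (cases b) (simp_all add: sum.distrib del: sum.lessThan_Suc)
    also have "\<dots> = ?B $$ (a, b)" using ab step[of a "b - 1"] by (cases b) auto
    finally show "?B $$ (a, b) = (?A * ?Y) $$ (a, b)" by simp
  qed auto
  then have "det ?A = det ?B"
    using det_mult[of ?A "Suc k" ?Y] Y by simp
  also have "\<dots> = (\<Sum>j<Suc k. ?B $$ (0, j) * cofactor ?B 0 j)"
    by (rule laplace_expansion_row) auto
  also have "\<dots> = v 0 0 * cofactor ?B 0 0"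
    unfolding sum.lessThan_Suc_shift using zero by simp
  also have "mat_delete ?B 0 0 = mat k k (\<lambda>(a, b). v' (Suc a) (Suc b))"
    by (rule eq_matI) (auto simp: mat_delete_def)
  then have "cofactor ?B 0 0 = det (mat k k (\<lambda>(a, b). v' (Suc a) (Suc b)))"
    by (simp add: cofactor_def)
  finally show ?thesis .
qed

text \<open>Undoes one round of elimination. The columns are restored from left to right: when
  column \<open>p + 1\<close> is treated, column \<open>p\<close> already agrees with
  \<open>V\<close>, so each restoration is right multiplication by one generator.\<close>

lemma U_pos_upt_columns:
  assumes V: "V \<in> carrier_mat n n" "V' \<in> carrier_mat n n" and "m < n"
    and a: "\<And>c. m \<le> c \<Longrightarrow> Suc c < n \<Longrightarrow> a c > 0"
    and step: "\<And>r c. r < n \<Longrightarrow> m \<le> c \<Longrightarrow> Suc c < n \<Longrightarrow>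
      V $$ (r, Suc c) = V' $$ (r, Suc c) + a c * V $$ (r, c)"
    and same: "\<And>r c. r < n \<Longrightarrow> c \<le> m \<Longrightarrow> V $$ (r, c) = V' $$ (r, c)"
  shows "\<exists>X \<in> U_pos n [m..<n - 1]. V = V' * X"
proof -
  \<comment> \<open>The intermediate stage: columns up to \<open>p\<close> are restored, the others
    are still those of \<open>V'\<close>.\<close>
  define H where "H = (\<lambda>p. mat n n (\<lambda>(r, c). if c \<le> p then V $$ (r, c) else V' $$ (r, c)))"
  have "\<exists>X \<in> U_pos n [m..<p]. H p = V' * X" if "m \<le> p" "p \<le> n - 1" for p
    using that
  proof (induction rule: dec_induct)
    case base
    have "H m = V' * 1\<^sub>m n" using V same by (auto simp: H_def intro!: eq_matI)
    then show ?case by simp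
  next
    case (step p)
    then obtain X where X: "X \<in> U_pos n [m..<p]" "H p = V' * X" by auto
    have p: "m \<le> p" "Suc p < n" using step by auto
    have Hc: "H p \<in> carrier_mat n n" by (simp add: H_def)
    have "xmat n p (a p) * 1\<^sub>m n \<in> U_pos n [p]" by (rule U_pos_ConsI) (use a p in auto)
    then have x: "xmat n p (a p) \<in> U_pos n [p]" by (simp add: right_mult_one_mat[OF xmat_carrier])
    have "H (Suc p) = addcol (a p) (Suc p) p (H p)"
      by (rule eq_matI) (use p assms(5) in \<open>auto simp: H_def mat_addcol_def le_Suc_eq\<close>)
    also have "\<dots> = V' * X * xmat n p (a p)" using mult_xmat[OF Hc p(2)] X(2) by simp
    also have "\<dots> = V' * (X * xmat n p (a p))"
      by (rule assoc_mult_mat[OF V(2) U_pos_carrier[OF X(1)] xmat_carrier])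
    finally show ?case using U_pos_append[OF X(1) x] p by auto
  qed
  moreover have "m \<le> n - 1" using assms(3) by simp
  ultimately obtain X where X: "X \<in> U_pos n [m..<n - 1]" "H (n - 1) = V' * X"
    by blast
  have "V = H (n - 1)" by (rule eq_matI) (use V in \<open>auto simp: H_def\<close>)
  then show ?thesis using X by auto
qed

text \<open>Neville elimination: subtracting from each column a multiple of its left neighbour clears the
  first row of the active block and divides the minors on consecutive columns by one entry, so only
  these minors have to be controlled.\<close>

lemma lower_U_pos_factorization:
  assumes "d \<le> n" "V \<in> carrier_mat n n"
    and "\<And>r c. r < n - d \<Longrightarrow> c < n \<Longrightarrow> r < c \<Longrightarrow> V $$ (r, c) = 0"
    and "\<And>r. r < n - d \<Longrightarrow> V $$ (r, r) \<noteq> 0"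
    and "\<And>j k. n - d \<le> j \<Longrightarrow> j + k \<le> n \<Longrightarrow>
      det (mat k k (\<lambda>(a, b). V $$ (n - d + a, j + b))) > 0"
  shows "\<exists>L \<in> lower_tri_inv n. \<exists>X \<in> U_pos n (std_word n d). V = L * X"
  using assms
proof (induction d arbitrary: V)
  case 0
  have "det V = prod_list (diag_mat V)"
    by (rule det_lower_triangular) (use 0 in auto)
  also have "\<dots> \<noteq> 0" unfolding prod_list_diag_prod using 0 by auto
  finally have "V \<in> lower_tri_inv n" using 0 by (auto simp: lower_tri_inv_def GL_def)
  moreover have "V = V * 1\<^sub>m n" using 0 by simp
  ultimately show ?case by auto
next
  case (Suc d)
  define m where "m = n - Suc d"
  have m: "m < n" "n - d = Suc m" using Suc.prems(1) by (auto simp: m_def)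
  note V = Suc.prems(2) and upper = Suc.prems(3)[folded m_def] and diag = Suc.prems(4)[folded m_def]
    and minors = Suc.prems(5)[folded m_def]
  have pos: "V $$ (m, c) > 0" if "m \<le> c" "c < n" for c
  proof -
    have "det (mat 1 1 (\<lambda>(a, b). V $$ (m + a, c + b))) > 0" by (rule minors) (use that in auto)
    then show ?thesis by (simp add: det_single)
  qed
  \<comment> \<open>The multiplier that cancels the entry of row \<open>m\<close> in column
    \<open>c + 1\<close>.\<close>
  define a where "a = (\<lambda>c. V $$ (m, Suc c) / V $$ (m, c))"
  define V' where "V' = mat n n (\<lambda>(r, c). if m < c then V $$ (r, c) - a (c - 1) * V $$ (r, c - 1)
    else V $$ (r, c))"
  have V': "V' \<in> carrier_mat n n" by (simp add: V'_def)
  have row: "V' $$ (m, Suc c) = 0" if "m \<le> c" "Suc c < n" for c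
    using that m pos[of c] by (auto simp: V'_def a_def)
  have "\<exists>L \<in> lower_tri_inv n. \<exists>X \<in> U_pos n (std_word n d). V' = L * X"
  proof (rule Suc.IH[OF _ V'])
    show "d \<le> n" using Suc.prems(1) by simp
    show "V' $$ (r, c) = 0" if "r < n - d" "c < n" "r < c" for r c
    proof (cases "r = m")
      case True
      then show ?thesis using that row[of "c - 1"] by simp
    next
      case False
      then have "r < m" using that m by simp
      then show ?thesis using that m upper by (auto simp: V'_def)
    qed
    show "V' $$ (r, r) \<noteq> 0" if "r < n - d" for r
      using that m diag[of r] pos[of m] by (cases "r = m") (auto simp: V'_def)
    show "det (mat k k (\<lambda>(a, b). V' $$ (n - d + a, j + b))) > 0" if jk: "n - d \<le> j" "j + k \<le> n" for j k
    proof -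
      obtain j' where j': "j = Suc j'" "m \<le> j'" using jk(1) m(2) by (cases j) auto
      show ?thesis
      proof (cases "k = 0")
        case False
        then have kn: "m + k < n" "j' + k < n" using jk j' by auto
        \<comment> \<open>A minor of \<open>V\<close> that starts one row higher and one column
          further left is a positive entry times the wanted minor of \<open>V'\<close>.\<close>
        have "det (mat (Suc k) (Suc k) (\<lambda>(a, b). V $$ (m + a, j' + b))) =
            V $$ (m + 0, j' + 0) * det (mat k k (\<lambda>(a, b). V' $$ (m + Suc a, j' + Suc b)))"
          by (rule det_eliminate_first_row[where c = "\<lambda>b. a (j' + b)"])
            (use kn j' row in \<open>auto simp: V'_def\<close>)
        moreover have "det (mat (Suc k) (Suc k) (\<lambda>(a, b). V $$ (m + a, j' + b))) > 0"
          by (rule minors) (use j' kn in auto)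
        ultimately have "det (mat k k (\<lambda>(a, b). V' $$ (m + Suc a, j' + Suc b))) > 0"
          using pos[of j'] kn j' by (simp add: zero_less_mult_iff)
        then show ?thesis by (simp add: m j')
      qed simp
    qed
  qed
  then obtain L X where LX: "L \<in> lower_tri_inv n" "X \<in> U_pos n (std_word n d)" "V' = L * X" by auto
  have "\<exists>Y \<in> U_pos n [m..<n - 1]. V = V' * Y"
    by (rule U_pos_upt_columns[OF V V' m(1), where a = a])
      (use pos m in \<open>auto simp: V'_def, auto simp: a_def\<close>)
  then obtain Y where Y: "Y \<in> U_pos n [m..<n - 1]" "V = V' * Y" by auto
  have "L \<in> carrier_mat n n" using LX(1) by (auto simp: lower_tri_inv_def GL_def)
  then have "V = L * (X * Y)"
    unfolding Y(2) LX(3) by (rule assoc_mult_mat[OF _ U_pos_carrier[OF LX(2)] U_pos_carrier[OF Y(1)]])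
  then show ?case using LX(1) U_pos_append[OF LX(2) Y(1)] by (auto simp: m_def)
qed

text \<open>With \<open>d = n\<close> the active block is the whole matrix, and the minors to be
  controlled are the coordinates of intervals of columns.\<close>

lemma flag_positive_factorization:
  assumes N: "N \<in> carrier_mat n n" and pos: "\<forall>I \<subseteq> {0..<n}. plucker N I > 0"
  shows "\<exists>L \<in> lower_tri_inv n. \<exists>X \<in> U_pos n (std_word n n). N = L * X"
proof (rule lower_U_pos_factorization[OF order_refl N])
  show "det (mat k k (\<lambda>(a, b). N $$ (n - n + a, j + b))) > 0" if "j + k \<le> n" for j k
  proof -
    have I: "{j..<j + k} \<subseteq> {0..<n}" using that by auto
    have "plucker N {j..<j + k} = det (mat k k (\<lambda>(a, b). N $$ (a, j + b)))"
      by (rule plucker_eq_det[OF N I])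
        (auto simp: strict_mono_on_def lessThan_atLeast0 add.commute)
    then show ?thesis using pos[rule_format, OF I] by simp
  qed
qed auto

section \<open>The closure\<close>

lemma lower_tri_inv_carrier: "L \<in> lower_tri_inv n \<Longrightarrow> L \<in> carrier_mat n n"
  by (simp add: lower_tri_inv_def GL_def)

lemma lower_tri_inv_diag:
  assumes "L \<in> lower_tri_inv n" "i < n"
  shows "L $$ (i, i) \<noteq> 0"
proof -
  have "det L = prod_list (diag_mat L)"
    by (rule det_lower_triangular[of n]) (use assms in \<open>auto simp: lower_tri_inv_def GL_def\<close>)
  then have "prod_list (diag_mat L) \<noteq> 0" using assms by (simp add: lower_tri_inv_def GL_def)
  then show ?thesis
    unfolding prod_list_diag_prod using assms lower_tri_inv_carrier[of L n] by auto
qed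

lemma one_lower_tri_inv: "1\<^sub>m n \<in> lower_tri_inv n"
  by (auto simp: lower_tri_inv_def GL_def)

lemma lower_tri_inv_mult:
  assumes "A \<in> lower_tri_inv n" "B \<in> lower_tri_inv n"
  shows "A * B \<in> lower_tri_inv n"
proof -
  note c = lower_tri_inv_carrier[OF assms(1)] lower_tri_inv_carrier[OF assms(2)]
  have "(A * B) $$ (i, j) = 0" if "i < n" "j < n" "i < j" for i j
  proof -
    have "(A * B) $$ (i, j) = (\<Sum>k = 0..<n. A $$ (i, k) * B $$ (k, j))"
      using c that by (auto simp: scalar_prod_def intro!: sum.cong)
    also have "\<dots> = 0"
    proof (rule sum.neutral, rule ballI)
      fix k assume "k \<in> {0..<n}"
      then show "A $$ (i, k) * B $$ (k, j) = 0"
        using assms that by (cases "i < k") (auto simp: lower_tri_inv_def)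
    qed
    finally show ?thesis .
  qed
  then show ?thesis
    using assms c det_mult[OF c] by (auto simp: lower_tri_inv_def GL_def)
qed

lemma lower_tri_inv_inverse:
  assumes A: "A \<in> lower_tri_inv n"
  shows "\<exists>B \<in> lower_tri_inv n. B * A = 1\<^sub>m n"
proof -
  note Ac = lower_tri_inv_carrier[OF A]
  have "A \<in> Units (ring_mat TYPE(real) n ())"
    by (rule det_non_zero_imp_unit[OF Ac]) (use A in \<open>simp add: lower_tri_inv_def GL_def\<close>)
  then obtain B where B: "B \<in> carrier_mat n n" "A * B = 1\<^sub>m n" "B * A = 1\<^sub>m n"
    by (auto simp: Units_def ring_mat_def)
  \<comment> \<open>In entry \<open>(i, j)\<close> of \<open>A * B\<close> the terms with
    \<open>k < i\<close> vanish by induction and those with \<open>k > i\<close> by triangularity of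
    \<open>A\<close>. What remains is a nonzero diagonal entry times
    \<open>B $$ (i, j)\<close>.\<close>
  have "B $$ (i, j) = 0" if "i < j" "j < n" for i j
    using that
  proof (induction i rule: less_induct)
    case (less i)
    have "(\<Sum>k = 0..<n. A $$ (i, k) * B $$ (k, j)) = (A * B) $$ (i, j)"
      using Ac B(1) less.prems by (auto simp: scalar_prod_def intro!: sum.cong)
    also have "\<dots> = 0" using B(2) less.prems by simp
    also have "(\<Sum>k = 0..<n. A $$ (i, k) * B $$ (k, j)) = (\<Sum>k\<in>{i}. A $$ (i, k) * B $$ (k, j))"
    proof (rule sum.mono_neutral_right, goal_cases)
      case 3
      show ?case
      proof
        fix k assume k: "k \<in> {0..<n} - {i}"
        show "A $$ (i, k) * B $$ (k, j) = 0"
          using A k less by (cases "i < k") (auto simp: lower_tri_inv_def)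
      qed
    qed (use less.prems in auto)
    finally show ?case using lower_tri_inv_diag[OF A, of i] less.prems by simp
  qed
  moreover have "det B \<noteq> 0" using det_mult[OF B(1) Ac] B(3) by auto
  ultimately have "B \<in> lower_tri_inv n" using B(1) by (auto simp: lower_tri_inv_def GL_def)
  then show ?thesis using B(3) by auto
qed

lemma flag_of_self: "M \<in> carrier_mat n n \<Longrightarrow> M \<in> flag_of n M"
  unfolding flag_of_def using one_lower_tri_inv by (auto intro!: bexI[of _ "1\<^sub>m n"])

lemma flag_of_lower_mult:
  assumes L: "L \<in> lower_tri_inv n" and M: "M \<in> carrier_mat n n"
  shows "flag_of n (L * M) = flag_of n M"
proof (intro equalityI subsetI)
  note Lc = lower_tri_inv_carrier[OF L]
  fix X
  {
    assume "X \<in> flag_of n (L * M)"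
    then obtain A where A: "A \<in> lower_tri_inv n" "X = A * (L * M)" by (auto simp: flag_of_def)
    have "X = (A * L) * M"
      unfolding A(2) by (rule assoc_mult_mat[OF lower_tri_inv_carrier[OF A(1)] Lc M, symmetric])
    then show "X \<in> flag_of n M" using lower_tri_inv_mult[OF A(1) L] by (auto simp: flag_of_def)
  next
    assume "X \<in> flag_of n M"
    then obtain A where A: "A \<in> lower_tri_inv n" "X = A * M" by (auto simp: flag_of_def)
    obtain B where B: "B \<in> lower_tri_inv n" "B * L = 1\<^sub>m n" using lower_tri_inv_inverse[OF L] by auto
    note Ac = lower_tri_inv_carrier[OF A(1)] and Bc = lower_tri_inv_carrier[OF B(1)]
    have "A * B * (L * M) = A * (B * (L * M))" by (rule assoc_mult_mat[OF Ac Bc mult_carrier_mat[OF Lc M]])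
    also have "B * (L * M) = B * L * M" by (rule assoc_mult_mat[OF Bc Lc M, symmetric])
    finally have "X = A * B * (L * M)" using A(2) B(2) M by simp
    then show "X \<in> flag_of n (L * M)"
      using lower_tri_inv_mult[OF A(1) B(1)] by (auto simp: flag_of_def)
  }
qed

text \<open>The first \<open>k\<close> rows of the product involve only the first \<open>k\<close>
  rows of \<open>M\<close>, through the leading block of \<open>L\<close>. The factor therefore
  depends on \<open>I\<close> only through its size.\<close>

lemma plucker_lower_mult:
  assumes L: "L \<in> lower_tri_inv n" and M: "M \<in> carrier_mat n n" and I: "I \<subseteq> {0..<n}"
  shows "plucker (L * M) I = (\<Prod>i<card I. L $$ (i, i)) * plucker M I"
proof -
  note Lc = lower_tri_inv_carrier[OF L]
  have fin: "finite I" using I finite_subset by blast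
  define k where "k = card I"
  define f where "f = pick I"
  have f: "strict_mono_on {..<k} f" "f ` {..<k} = I"
    using strict_mono_on_pick pick_image[OF fin] by (auto simp: f_def k_def)
  have fn: "f b < n" if "b < k" for b using f(2) I that by auto
  have kn: "k \<le> n" using card_mono[OF _ I] k_def by simp
  let ?L = "mat k k (\<lambda>(a, b). L $$ (a, b))" and ?M = "mat k k (\<lambda>(a, b). M $$ (a, f b))"
  have "mat k k (\<lambda>(a, b). (L * M) $$ (a, f b)) = ?L * ?M"
  proof (rule eq_matI)
    fix a b assume "a < dim_row (?L * ?M)" "b < dim_col (?L * ?M)"
    then have ab: "a < k" "b < k" by auto
    have "(L * M) $$ (a, f b) = (\<Sum>i = 0..<n. L $$ (a, i) * M $$ (i, f b))"
      using Lc M ab kn fn by (auto simp: scalar_prod_def intro!: sum.cong)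
    also have "\<dots> = (\<Sum>i = 0..<k. L $$ (a, i) * M $$ (i, f b))"
      by (rule sum.mono_neutral_right) (use L ab kn in \<open>auto simp: lower_tri_inv_def\<close>)
    also have "\<dots> = (?L * ?M) $$ (a, b)"
      using ab by (auto simp: scalar_prod_def intro!: sum.cong)
    finally show "mat k k (\<lambda>(a, b). (L * M) $$ (a, f b)) $$ (a, b) = (?L * ?M) $$ (a, b)"
      using ab by simp
  qed auto
  then have "plucker (L * M) I = det ?L * det ?M"
    using plucker_eq_det[OF mult_carrier_mat[OF Lc M] I f] det_mult[of ?L k ?M] by simp
  moreover have "det ?L = prod_list (diag_mat ?L)"
    by (rule det_lower_triangular[of k]) (use L kn in \<open>auto simp: lower_tri_inv_def\<close>)
  then have "det ?L = (\<Prod>i<k. L $$ (i, i))"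
    by (simp add: prod_list_diag_prod lessThan_atLeast0)
  ultimately show ?thesis using plucker_eq_det[OF M I f] k_def by simp
qed

section \<open>Continuity of the coordinates and open sets of flags\<close>

lemma tendsto_plucker:
  fixes N :: "nat \<Rightarrow> real mat"
  assumes M: "M \<in> carrier_mat n n" and N: "\<And>m. N m \<in> carrier_mat n n" and I: "I \<subseteq> {0..<n}"
    and lim: "\<And>i j. i < n \<Longrightarrow> j < n \<Longrightarrow> (\<lambda>m. N m $$ (i, j)) \<longlonglongrightarrow> M $$ (i, j)"
  shows "(\<lambda>m. plucker (N m) I) \<longlonglongrightarrow> plucker M I"
proof -
  have fin: "finite I" using I finite_subset by blast
  define k where "k = card I"
  define f where "f = pick I"
  have f: "strict_mono_on {..<k} f" "f ` {..<k} = I"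
    using strict_mono_on_pick pick_image[OF fin] by (auto simp: f_def k_def)
  have fn: "f b < n" if "b < k" for b using f(2) I that by auto
  have kn: "k \<le> n" using card_mono[OF _ I] k_def by simp
  \<comment> \<open>The Leibniz formula displays the coordinate as a polynomial in the
    entries.\<close>
  have eq: "plucker A I = (\<Sum>p | p permutes {0..<k}. signof p * (\<Prod>i = 0..<k. A $$ (i, f (p i))))"
    if "A \<in> carrier_mat n n" for A :: "real mat"
    unfolding plucker_eq_det[OF that I f] det_def'[OF mat_carrier]
  proof (intro sum.cong refl arg_cong2[of _ _ _ _ "(*)"] prod.cong)
    fix p i assume "p \<in> {p. p permutes {0..<k}}" "i \<in> {0..<k}"
    then have "i < k" "p i < k" using permutes_in_image[of p "{0..<k}" i] by auto
    then show "mat k k (\<lambda>(a, b). A $$ (a, f b)) $$ (i, p i) = A $$ (i, f (p i))" by simp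
  qed
  show ?thesis
    unfolding eq[OF M] eq[OF N]
  proof (intro tendsto_sum tendsto_mult tendsto_const tendsto_prod lim)
    fix p i assume "p \<in> {p. p permutes {0..<k}}" "i \<in> {0..<k}"
    then have "i < k" "p i < k" using permutes_in_image[of p "{0..<k}" i] by auto
    then show "i < n" "f (p i) < n" using kn fn by auto
  qed
qed

text \<open>Recasts sequential continuity in the entrywise form used by \<open>GL_open\<close>: a
  failure would give matrices within \<open>1/(m+1)\<close> of \<open>M\<close> whose coordinates
  stay away from that of \<open>M\<close>.\<close>

lemma plucker_continuous:
  assumes M: "M \<in> carrier_mat n n" and I: "I \<subseteq> {0..<n}" and e: "e > 0"
  shows "\<exists>d>0. \<forall>N \<in> carrier_mat n n. (\<forall>i<n. \<forall>j<n. \<bar>N $$ (i, j) - M $$ (i, j)\<bar> < d) \<longrightarrow>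
    \<bar>plucker N I - plucker M I\<bar> < e"
proof (rule ccontr)
  assume neg: "\<not> ?thesis"
  have "\<exists>N \<in> carrier_mat n n. (\<forall>i<n. \<forall>j<n. \<bar>N $$ (i, j) - M $$ (i, j)\<bar> < inverse (real (Suc m))) \<and>
      \<not> \<bar>plucker N I - plucker M I\<bar> < e" for m
  proof -
    have "inverse (real (Suc m)) > 0" by simp
    then show ?thesis using neg by blast
  qed
  then obtain N where N: "\<And>m. N m \<in> carrier_mat n n"
    "\<And>m i j. i < n \<Longrightarrow> j < n \<Longrightarrow> \<bar>N m $$ (i, j) - M $$ (i, j)\<bar> < inverse (real (Suc m))"
    "\<And>m. \<not> \<bar>plucker (N m) I - plucker M I\<bar> < e"
    by metis
  have "(\<lambda>m. plucker (N m) I) \<longlonglongrightarrow> plucker M I"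
  proof (rule tendsto_plucker[OF M N(1) I])
    fix i j assume ij: "i < n" "j < n"
    have "(\<lambda>m. N m $$ (i, j) - M $$ (i, j)) \<longlonglongrightarrow> 0"
    proof (rule tendsto_0_le[OF LIMSEQ_inverse_real_of_nat, of _ 1])
      show "\<forall>\<^sub>F m in sequentially.
          norm (N m $$ (i, j) - M $$ (i, j)) \<le> norm (inverse (real (Suc m))) * 1"
        using N(2)[OF ij, THEN less_imp_le] by (intro always_eventually allI) simp
    qed
    then show "(\<lambda>m. N m $$ (i, j)) \<longlonglongrightarrow> M $$ (i, j)" by (rule LIM_zero_cancel)
  qed
  then obtain m where "\<bar>plucker (N m) I - plucker M I\<bar> < e"
    using e by (auto simp: LIMSEQ_iff)
  then show False using N(3) by blast
qed

lemma GL_open_opposite_signs: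
  assumes I: "I \<subseteq> {0..<n}" and J: "J \<subseteq> {0..<n}"
  shows "GL_open n {M \<in> GL n. plucker M I > 0 \<and> plucker M J < 0}"
  unfolding GL_open_def
proof (intro conjI ballI)
  fix M assume M: "M \<in> {M \<in> GL n. plucker M I > 0 \<and> plucker M J < 0}"
  then have Mc: "M \<in> carrier_mat n n" by (simp add: GL_def)
  obtain d1 where d1: "d1 > 0" "\<And>N. N \<in> carrier_mat n n \<Longrightarrow>
      (\<forall>i<n. \<forall>j<n. \<bar>N $$ (i, j) - M $$ (i, j)\<bar> < d1) \<Longrightarrow>
      \<bar>plucker N I - plucker M I\<bar> < plucker M I"
    using plucker_continuous[OF Mc I, of "plucker M I"] M by blast
  obtain d2 where d2: "d2 > 0" "\<And>N. N \<in> carrier_mat n n \<Longrightarrow>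
      (\<forall>i<n. \<forall>j<n. \<bar>N $$ (i, j) - M $$ (i, j)\<bar> < d2) \<Longrightarrow>
      \<bar>plucker N J - plucker M J\<bar> < - plucker M J"
    using plucker_continuous[OF Mc J, of "- plucker M J"] M by fastforce
  have "N \<in> {M \<in> GL n. plucker M I > 0 \<and> plucker M J < 0}"
    if "N \<in> GL n" "\<forall>i<n. \<forall>j<n. \<bar>N $$ (i, j) - M $$ (i, j)\<bar> < min d1 d2" for N
    using d1(2)[of N] d2(2)[of N] that by (auto simp: GL_def)
  then show "\<exists>e>0. \<forall>N\<in>GL n. (\<forall>i<n. \<forall>j<n. \<bar>N $$ (i, j) - M $$ (i, j)\<bar> < e) \<longrightarrow>
      N \<in> {M \<in> GL n. plucker M I > 0 \<and> plucker M J < 0}"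
    using d1(1) d2(1) by (intro exI[of _ "min d1 d2"]) auto
qed auto

text \<open>A single Pluecker coordinate has no well-defined sign on a flag, but whether two coordinates of
  the same size have opposite signs does not depend on the representative.\<close>

lemma opposite_signs_saturated:
  assumes M: "M \<in> GL n" and N: "N \<in> GL n" and eq: "flag_of n M = flag_of n N"
    and I: "I \<subseteq> {0..<n}" and J: "J \<subseteq> {0..<n}" "card I = card J"
  shows "plucker M I * plucker M J < 0 \<longleftrightarrow> plucker N I * plucker N J < 0"
proof -
  have Nc: "N \<in> carrier_mat n n" and Mc: "M \<in> carrier_mat n n" using M N by (auto simp: GL_def)
  obtain L where L: "L \<in> lower_tri_inv n" "M = L * N"
    using flag_of_self[OF Mc] eq by (auto simp: flag_of_def)
  define d where "d = (\<Prod>i<card I. L $$ (i, i))"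
  have "card I \<le> n" using card_mono[OF _ I] by simp
  then have "d \<noteq> 0" using lower_tri_inv_diag[OF L(1)] by (auto simp: d_def)
  moreover have "plucker M I * plucker M J = d\<^sup>2 * (plucker N I * plucker N J)"
    using plucker_lower_mult[OF L(1) Nc I] plucker_lower_mult[OF L(1) Nc J(1)] J(2) L(2)
    by (simp add: d_def power2_eq_square)
  ultimately show ?thesis by (simp add: mult_less_0_iff zero_less_mult_iff)
qed

lemma GL_open_Un:
  assumes S: "GL_open n S" and T: "GL_open n T"
  shows "GL_open n (S \<union> T)"
  unfolding GL_open_def
proof (intro conjI ballI)
  fix M assume "M \<in> S \<union> T"
  then show "\<exists>e>0. \<forall>N\<in>GL n. (\<forall>i<n. \<forall>j<n. \<bar>N $$ (i, j) - M $$ (i, j)\<bar> < e) \<longrightarrow> N \<in> S \<union> T"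
  proof
    assume "M \<in> S"
    then show ?thesis using S unfolding GL_open_def by blast
  next
    assume "M \<in> T"
    then show ?thesis using T unfolding GL_open_def by blast
  qed
qed (use S T in \<open>auto simp: GL_open_def\<close>)

text \<open>By \<open>opposite_signs_saturated\<close> the matrices representing these flags are
  exactly those satisfying the sign condition, a union of two open sets.\<close>

lemma Fl_open_opposite_signs:
  assumes I: "I \<subseteq> {0..<n}" and J: "J \<subseteq> {0..<n}" "card I = card J"
  shows "Fl_open n (flag_of n ` {M \<in> GL n. plucker M I * plucker M J < 0})"
proof -
  have "{M \<in> GL n. flag_of n M \<in> flag_of n ` {M \<in> GL n. plucker M I * plucker M J < 0}} =
      {M \<in> GL n. plucker M I * plucker M J < 0}"
  proof (intro equalityI subsetI)
    fix M assume "M \<in> {M \<in> GL n. flag_of n M \<in> flag_of n ` {M \<in> GL n. plucker M I * plucker M J < 0}}"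
    then obtain N where N: "M \<in> GL n" "N \<in> GL n" "flag_of n M = flag_of n N"
      "plucker N I * plucker N J < 0" by auto
    then show "M \<in> {M \<in> GL n. plucker M I * plucker M J < 0}"
      using opposite_signs_saturated[OF N(1-3) I J] by simp
  qed blast
  also have "\<dots> = {M \<in> GL n. plucker M I > 0 \<and> plucker M J < 0} \<union>
      {M \<in> GL n. plucker M J > 0 \<and> plucker M I < 0}"
    by (auto simp: mult_less_0_iff)
  also have "GL_open n \<dots>"
    by (intro GL_open_Un GL_open_opposite_signs I J)
  finally show ?thesis unfolding Fl_open_def Fl_def by blast
qed

lemma plucker_empty: "M \<in> carrier_mat n n \<Longrightarrow> plucker M {} = 1"
  using plucker_eq_det[of M n "{}" 0 id] by simp

lemma flag_nonneg_representative:
  assumes M: "M \<in> GL n"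
    and sgn: "\<And>I J. I \<subseteq> {0..<n} \<Longrightarrow> J \<subseteq> {0..<n} \<Longrightarrow> card I = card J \<Longrightarrow> plucker M I * plucker M J \<ge> 0"
  shows "\<exists>N \<in> GL n. flag_of n M = flag_of n N \<and> flag_nonneg n N"
proof -
  have Mc: "M \<in> carrier_mat n n" using M by (simp add: GL_def)
  \<comment> \<open>One sign per size: once a size has a negative coordinate, \<open>sgn\<close>
    makes all its coordinates non-positive.\<close>
  define s :: "nat \<Rightarrow> real" where
    "s = (\<lambda>k. if \<exists>J \<subseteq> {0..<n}. card J = k \<and> plucker M J < 0 then -1 else 1)"
  have s: "s (card I) * plucker M I \<ge> 0" if I: "I \<subseteq> {0..<n}" for I
  proof (cases "\<exists>J \<subseteq> {0..<n}. card J = card I \<and> plucker M J < 0")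
    case True
    then obtain J where "J \<subseteq> {0..<n}" "card J = card I" "plucker M J < 0" by auto
    then have "plucker M I \<le> 0" using sgn[OF I, of J] by (auto simp: zero_le_mult_iff)
    moreover have "s (card I) = -1" using True by (simp only: s_def if_True)
    ultimately show ?thesis by simp
  next
    case False
    then have "s (card I) = 1" by (simp only: s_def if_False)
    moreover have "\<not> plucker M I < 0" using False I by blast
    ultimately show ?thesis by simp
  qed
  have s2: "s k * s k = 1" for k by (simp add: s_def)
  \<comment> \<open>The coordinate of the empty set is always 1, so size 0 needs no correction; the
    telescoping product below starts from this value.\<close>
  have "\<not> plucker M J < 0" if "J \<subseteq> {0..<n}" "card J = 0" for J
    using that finite_subset[OF that(1)] plucker_empty[OF Mc] by simp
  then have s0: "s 0 = 1" unfolding s_def by meson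
  \<comment> \<open>The diagonal entries are the ratios of successive signs, so the leading minor of
    size \<open>k\<close> telescopes to \<open>s k\<close>.\<close>
  define D where "D = mat n n (\<lambda>(i, j). if i = j then s (Suc i) * s i else 0)"
  have snz: "s k \<noteq> 0" for k by (simp add: s_def)
  have "det D = prod_list (diag_mat D)"
    by (rule det_lower_triangular[of n]) (auto simp: D_def)
  also have "\<dots> \<noteq> 0" unfolding prod_list_diag_prod by (simp add: D_def snz)
  finally have D: "D \<in> lower_tri_inv n" by (auto simp: lower_tri_inv_def GL_def D_def)
  have prod_D: "(\<Prod>i<k. D $$ (i, i)) = s k" if "k \<le> n" for k
    using that
  proof (induction k)
    case (Suc k)
    then have "(\<Prod>i<Suc k. D $$ (i, i)) = s k * (s (Suc k) * s k)" by (simp add: D_def)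
    also have "\<dots> = s (Suc k) * (s k * s k)" by simp
    finally show ?case by (simp add: s2)
  qed (simp add: s0)
  have "flag_nonneg n (D * M)"
    unfolding flag_nonneg_def
  proof (intro allI impI)
    fix I :: "nat set" assume I: "I \<subseteq> {0..<n}"
    have "card I \<le> n" using card_mono[OF _ I] by simp
    then show "0 \<le> plucker (D * M) I"
      using s[OF I] by (simp add: plucker_lower_mult[OF D Mc I] prod_D)
  qed
  moreover have "D * M \<in> GL n"
    using D M det_mult[OF lower_tri_inv_carrier[OF D] Mc] lower_tri_inv_carrier[OF D] Mc
    by (auto simp: GL_def lower_tri_inv_def)
  ultimately show ?thesis using flag_of_lower_mult[OF D Mc] by metis
qed

theorem theorem3:
  fixes n :: nat and ws :: "nat list"
  assumes "n \<ge> 2" and "reduced_word_w0 n ws"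
  shows "Fl_tnn n ws =
    {F \<in> Fl n. \<exists>M \<in> GL n. F = flag_of n M \<and> (\<forall>I \<subseteq> {0..<n}. plucker M I \<ge> 0)}"
proof (intro equalityI subsetI)
  fix F assume F: "F \<in> Fl_tnn n ws"
  then have FFl: "F \<in> Fl n" unfolding Fl_tnn_def Fl_closure_def by blast
  then obtain M where M: "M \<in> GL n" "F = flag_of n M" unfolding Fl_def by blast
  have "plucker M I * plucker M J \<ge> 0"
    if I: "I \<subseteq> {0..<n}" and J: "J \<subseteq> {0..<n}" "card I = card J" for I J
  proof (rule ccontr)
    let ?W = "flag_of n ` {M \<in> GL n. plucker M I * plucker M J < 0}"
    assume "\<not> ?thesis"
    then have "plucker M I * plucker M J < 0" by (simp only: not_le)
    then have "F \<in> ?W" using M by blast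
    \<comment> \<open>The flags with opposite signs at \<open>I\<close> and \<open>J\<close> form an
      open neighbourhood of \<open>F\<close>, which must meet the set whose closure is
      taken.\<close>
    then have "?W \<inter> flag_of n ` U_pos n ws \<noteq> {}"
      using F Fl_open_opposite_signs[OF I J] unfolding Fl_tnn_def Fl_closure_def by blast
    then obtain N X where N: "N \<in> GL n" "plucker N I * plucker N J < 0"
      and X: "X \<in> U_pos n ws" "flag_of n N = flag_of n X"
      by blast
    have Xc: "X \<in> carrier_mat n n" by (rule U_pos_carrier[OF X(1)])
    have "N \<in> flag_of n X" using flag_of_self[of N n] N(1) X(2) by (auto simp: GL_def)
    then obtain L where L: "L \<in> lower_tri_inv n" "N = L * X" by (auto simp: flag_of_def)
    have "det X \<noteq> 0" using N(1) L det_mult[OF lower_tri_inv_carrier[OF L(1)] Xc] by (auto simp: GL_def)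
    then have "X \<in> GL n" using Xc by (simp add: GL_def)
    then have "plucker X I * plucker X J < 0"
      using opposite_signs_saturated[OF N(1) _ X(2) I J] N(2) by simp
    moreover have "flag_nonneg n X"
      by (rule flag_nonneg_U_pos[OF _ X(1)]) (use assms(2) in \<open>simp add: reduced_word_w0_def\<close>)
    then have "plucker X I * plucker X J \<ge> 0" using I J by (simp add: flag_nonneg_def)
    ultimately show False by simp
  qed
  then obtain N where "N \<in> GL n" "F = flag_of n N" "flag_nonneg n N"
    using flag_nonneg_representative[OF M(1)] M(2) by blast
  then show "F \<in> {F \<in> Fl n. \<exists>M \<in> GL n. F = flag_of n M \<and> (\<forall>I \<subseteq> {0..<n}. plucker M I \<ge> 0)}"
    using FFl unfolding flag_nonneg_def by blast
next
  fix F assume F: "F \<in> {F \<in> Fl n. \<exists>M \<in> GL n. F = flag_of n M \<and> (\<forall>I \<subseteq> {0..<n}. plucker M I \<ge> 0)}"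
  then obtain M where M: "M \<in> GL n" "F = flag_of n M" "flag_nonneg n M"
    unfolding flag_nonneg_def by blast
  have "U \<inter> flag_of n ` U_pos n ws \<noteq> {}" if U: "Fl_open n U" "F \<in> U" for U
  proof -
    \<comment> \<open>The preimage of \<open>U\<close> is an open set of matrices around
      \<open>M\<close>, so it suffices to approximate \<open>M\<close> entrywise.\<close>
    let ?V = "{M \<in> GL n. flag_of n M \<in> U}"
    have "GL_open n ?V" using U(1) unfolding Fl_open_def ..
    moreover have "M \<in> ?V" using M(1,2) U(2) by simp
    ultimately have "\<exists>e>0. \<forall>N \<in> GL n. (\<forall>i<n. \<forall>j<n. \<bar>N $$ (i, j) - M $$ (i, j)\<bar> < e) \<longrightarrow> N \<in> ?V"
      unfolding GL_open_def by (elim conjE) (rule bspec)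
    then obtain e where e: "e > 0"
      "\<forall>N \<in> GL n. (\<forall>i<n. \<forall>j<n. \<bar>N $$ (i, j) - M $$ (i, j)\<bar> < e) \<longrightarrow> N \<in> ?V"
      by (elim exE conjE)
    obtain N where N: "N \<in> GL n" "\<forall>i<n. \<forall>j<n. \<bar>N $$ (i, j) - M $$ (i, j)\<bar> < e"
        "\<forall>I \<subseteq> {0..<n}. plucker N I > 0"
      using flag_positive_approximation[OF M(1,3) e(1)] by (elim bexE conjE)
    have Nc: "N \<in> carrier_mat n n" using N(1) by (simp add: GL_def)
    obtain L X where LX: "L \<in> lower_tri_inv n" "X \<in> U_pos n (std_word n n)" "N = L * X"
      using flag_positive_factorization[OF Nc N(3)] by auto
    have "flag_of n N = flag_of n X"
      unfolding LX(3) by (rule flag_of_lower_mult[OF LX(1) U_pos_carrier[OF LX(2)]])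
    \<comment> \<open>Elimination yields the standard word; invariance of \<open>U_pos\<close>
      transfers the point to the given one.\<close>
    moreover have "X \<in> U_pos n ws"
      using LX(2) U_pos_reduced_word_w0[OF assms(2) reduced_word_w0_std_word] by simp
    moreover have "flag_of n N \<in> U" using e(2) N(1,2) by simp
    ultimately show ?thesis by blast
  qed
  then show "F \<in> Fl_tnn n ws" using F unfolding Fl_tnn_def Fl_closure_def by blast
qed

end
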